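(* Let $(H,d)$ be a geodesic Gromov-hyperbolic space with basepoint $o$, and let $(M_n)$ be a non-elementary Markovian random walk on $\mathrm{Isom}(H)$ satisfying conditions $(A_1)$ and $(A_2')$. Then there exists a constant $\ell_\Lambda\ge0$ such that for every $\epsilon>0$ there exist $\alpha>0$ and $C>0$ such that for every $x\in E$, every $\xi\in\overline{H}^h$ and every $n\in\mathbb{N}$, \[ \mathbb{P}_x\big(|\sigma(M_n,\xi)-n\ell_\Lambda|\ge n\epsilon\big)\le Ce^{-\alpha n}. \]
   Context: $E$ is a countable set, $P$ an irreducible positively recurrent transition kernel on $E$ with stationary probability $\pi$, $\mathbb{P}_x$ the law of the Markov chain $(z_n)_{n\ge0}$ with $z_0=x$, $X:E\to\mathrm{Isom}(H)$ a map and $M_n=X(z_n)\cdots X(z_1)$. $H$ may be assumed separable. Horofunction compactification: for $x\in H$ let $h_x(y)=d(x,y)-d(x,o)$; $\overline{H}^h$ is the closure of $\{h_x\}$ in the space of $1$-Lipschitz functions vanishing at $o$ with the pointwise topology. Busemann cocycle: $\sigma(\gamma,h)=h(\gamma^{-1}o)$; $\kappa(\gamma)=d(\gamma o,o)$. $(A_1)$: there are $C>0,\rho\in(0,1)$ with $\|P^n(z,\cdot)-\pi\|_{TV}\le C\rho^n$ for all $z,n$. $(A_2')$: there are $a,B>0$ with $\mathbb{E}_x[e^{a\kappa(M_1)}]\le B$ for all $x\in E$. Non-elementary: there do not exist finitely many maps $V_i:E\to\partial H$ such that, with $W(x)=\bigcup_iV_i(x)$, for every $x_0\in E$ and $n$,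 $\mathbb{P}_{x_0}$-a.s. $M_nW(x_0)=W(z_n)$. *)

theory Defs
  imports "HOL-Analysis.Analysis" "HOL-Probability.Probability"
begin

definition gromov_product :: "'h::metric_space \<Rightarrow> 'h \<Rightarrow> 'h \<Rightarrow> real" where
  "gromov_product w x y = (dist w x + dist w y - dist x y) / 2"

definition gromov_hyperbolic :: "real \<Rightarrow> 'h::metric_space itself \<Rightarrow> bool" where
  "gromov_hyperbolic \<delta> TYPE('h) \<longleftrightarrow> \<delta> \<ge> 0 \<and>
     (\<forall>x y z w :: 'h. gromov_product w x z \<ge> min (gromov_product w x y) (gromov_product w y z) - \<delta>)"

definition geodesic_space :: "'h::metric_space itself \<Rightarrow> bool" where
  "geodesic_space TYPE('h) \<longleftrightarrow>
     (\<forall>x y :: 'h. \<exists>\<gamma> :: real \<Rightarrow> 'h. \<gamma> 0 = x \<and> \<gamma> (dist x y) = y \<and>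
        (\<forall>s\<in>{0..dist x y}. \<forall>t\<in>{0..dist x y}. dist (\<gamma> s) (\<gamma> t) = \<bar>s - t\<bar>))"

definition isometry :: "('h::metric_space \<Rightarrow> 'h) \<Rightarrow> bool" where
  "isometry g \<longleftrightarrow> bij g \<and> (\<forall>x y. dist (g x) (g y) = dist x y)"

definition converges_at_infinity :: "'h::metric_space \<Rightarrow> (nat \<Rightarrow> 'h) \<Rightarrow> bool" where
  "converges_at_infinity b xs \<longleftrightarrow>
     (\<forall>K. \<exists>N. \<forall>m\<ge>N. \<forall>n\<ge>N. gromov_product b (xs m) (xs n) \<ge> K)"

definition infinity_equiv :: "'h::metric_space \<Rightarrow> (nat \<Rightarrow> 'h) \<Rightarrow> (nat \<Rightarrow> 'h) \<Rightarrow> bool" where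
  "infinity_equiv b xs ys \<longleftrightarrow> (\<forall>K. \<exists>N. \<forall>n\<ge>N. gromov_product b (xs n) (ys n) \<ge> K)"

definition gromov_boundary :: "'h::metric_space \<Rightarrow> (nat \<Rightarrow> 'h) set set" where
  "gromov_boundary b = {{ys. converges_at_infinity b ys \<and> infinity_equiv b xs ys} | xs.
                          converges_at_infinity b xs}"

definition boundary_act :: "('h \<Rightarrow> 'h) \<Rightarrow> (nat \<Rightarrow> 'h) set \<Rightarrow> (nat \<Rightarrow> 'h) set" where
  "boundary_act g c = (\<lambda>xs. g \<circ> xs) ` c"

definition horofun :: "'h::metric_space \<Rightarrow> 'h \<Rightarrow> ('h \<Rightarrow> real)" where
  "horofun b x = (\<lambda>y. dist x y - dist x b)"

text \<open>Closure in the topology of pointwise convergence (product topology on functions).\<close>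
definition horo_compactification :: "'h::metric_space \<Rightarrow> ('h \<Rightarrow> real) set" where
  "horo_compactification b = closure (range (horofun b))"

definition busemann :: "'h \<Rightarrow> ('h \<Rightarrow> 'h) \<Rightarrow> ('h \<Rightarrow> real) \<Rightarrow> real" where
  "busemann b \<gamma> h = h (inv \<gamma> b)"

fun kernel_pow :: "('e \<Rightarrow> 'e pmf) \<Rightarrow> nat \<Rightarrow> 'e \<Rightarrow> 'e pmf" where
  "kernel_pow P 0 x = return_pmf x"
| "kernel_pow P (Suc n) x = bind_pmf (P x) (kernel_pow P n)"

text \<open>Law under P_x of the first n steps [z_1, ..., z_n] of the chain started at z_0 = x.\<close>
fun path_pmf :: "('e \<Rightarrow> 'e pmf) \<Rightarrow> nat \<Rightarrow> 'e \<Rightarrow> 'e list pmf" where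
  "path_pmf P 0 x = return_pmf []"
| "path_pmf P (Suc n) x = bind_pmf (P x) (\<lambda>y. map_pmf (Cons y) (path_pmf P n y))"

definition irreducible_kernel :: "('e \<Rightarrow> 'e pmf) \<Rightarrow> bool" where
  "irreducible_kernel P \<longleftrightarrow> (\<forall>x y. \<exists>n. pmf (kernel_pow P n x) y > 0)"

text \<open>Positive recurrence: E_x[tau_x] = sum_n P_x(tau_x > n) < infinity for every state x,
  where tau_x = inf {n \<ge> 1. z_n = x}.\<close>
definition positively_recurrent :: "('e \<Rightarrow> 'e pmf) \<Rightarrow> bool" where
  "positively_recurrent P \<longleftrightarrow>
     (\<forall>x. summable (\<lambda>n. measure_pmf.prob (path_pmf P n x) {zs. x \<notin> set zs}))"

definition stationary :: "('e \<Rightarrow> 'e pmf) \<Rightarrow> 'e pmf \<Rightarrow> bool" where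
  "stationary P \<pi> \<longleftrightarrow> bind_pmf \<pi> P = \<pi>"

definition tv_dist :: "'e pmf \<Rightarrow> 'e pmf \<Rightarrow> real" where
  "tv_dist \<mu> \<nu> = (SUP A. \<bar>measure_pmf.prob \<mu> A - measure_pmf.prob \<nu> A\<bar>)"

definition walk_prod :: "('e \<Rightarrow> ('h \<Rightarrow> 'h)) \<Rightarrow> 'e list \<Rightarrow> ('h \<Rightarrow> 'h)" where
  "walk_prod X zs = foldl (\<lambda>g z. X z \<circ> g) id zs"

definition cond_A1 :: "('e \<Rightarrow> 'e pmf) \<Rightarrow> 'e pmf \<Rightarrow> bool" where
  "cond_A1 P \<pi> \<longleftrightarrow> (\<exists>C>0. \<exists>\<rho>. 0 < \<rho> \<and> \<rho> < 1 \<and>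
      (\<forall>z n. tv_dist (kernel_pow P n z) \<pi> \<le> C * \<rho> ^ n))"

definition cond_A2' :: "('e \<Rightarrow> 'e pmf) \<Rightarrow> ('e \<Rightarrow> ('h::metric_space \<Rightarrow> 'h)) \<Rightarrow> 'h \<Rightarrow> bool" where
  "cond_A2' P X b \<longleftrightarrow> (\<exists>a>0. \<exists>B>0. \<forall>x.
      (\<integral>\<^sup>+ y. ennreal (exp (a * dist (X y b) b)) \<partial>measure_pmf (P x)) \<le> ennreal B)"

definition non_elementary :: "('e \<Rightarrow> 'e pmf) \<Rightarrow> ('e \<Rightarrow> ('h::metric_space \<Rightarrow> 'h)) \<Rightarrow> 'h \<Rightarrow> bool" where
  "non_elementary P X b \<longleftrightarrow>
     \<not> (\<exists>(k::nat) (V :: nat \<Rightarrow> 'e \<Rightarrow> (nat \<Rightarrow> 'h) set). k \<ge> 1 \<and>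
          (\<forall>i<k. \<forall>x. V i x \<in> gromov_boundary b) \<and>
          (let W = (\<lambda>x. {V i x | i. i < k}) in
           \<forall>x0 n. AE zs in measure_pmf (path_pmf P n x0).
              boundary_act (walk_prod X zs) ` W x0 = W (last (x0 # zs))))"

end

theory Submission
  imports Defs "HOL-Library.Ramsey"
begin

text \<open>
  Let \<open>M\<^sub>n\<close> be the walk, \<open>Y\<^sub>n = M\<^sub>n\<inverse> b\<close>, and let \<open>\<ell>\<close> be the escape rate of \<open>d(M\<^sub>n b, b)\<close>. For an interior
  point \<open>w\<close> the Busemann cocycle at the horofunction of \<open>w\<close> is
  \<open>d(M\<^sub>n w, b) - d(w, b) = d(M\<^sub>n b, b) - 2 (w|Y\<^sub>n)\<close>, and horofunctions in the closure are reduced to this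
  case by approximation on finite sets of paths. By the cocycle property and exponential moments,
  large deviations follow once the mean of this displacement over one time \<open>N\<close> is \<open>N \<ell> + o(N)\<close>
  uniformly in the starting state and in \<open>w\<close>. If \<open>\<ell> = 0\<close> this is clear. If \<open>\<ell> > 0\<close> it remains to show
  that \<open>(w|Y\<^sub>n) \<ge> \<epsilon> n\<close> has uniformly small probability.

  Under the stationary law, \<open>(Y\<^sub>m|Y\<^sub>n)\<close> has mean \<open>(a\<^sub>m + a\<^sub>n - a\<^bsub>n-m\<^esub>) / 2\<close> with \<open>a\<^sub>n\<close> the mean of
  \<open>d(M\<^sub>n b, b)\<close>. For two large \<open>m\<close>, \<open>m'\<close> some \<open>n\<close> makes both increments \<open>a\<^sub>n - a\<^bsub>n-m\<^esub>\<close>, \<open>a\<^sub>n - a\<^bsub>n-m'\<^esub>\<close>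
  almost maximal, so \<open>Y\<close> is a Cauchy sequence in probability for the Gromov product. If the shadows
  of some points \<open>w\<close> kept a definite probability, Ramsey's theorem would give a boundary point
  charged by the limit of \<open>Y\<close>. The maximal charge of a boundary point is subharmonic in the starting
  state, hence constant by mixing, and the finitely many points carrying it form an
  equivariant family, contradicting non-elementarity.
\<close>

section \<open>Gromov products\<close>

lemma gromov_product_commute: "gromov_product w x y = gromov_product w y x"
  by (simp add: gromov_product_def dist_commute)

lemma gromov_product_le_dist1: "gromov_product w x y \<le> dist w x"
  using dist_triangle[of w y x] by (simp add: gromov_product_def)

lemma gromov_product_le_dist2: "gromov_product w x y \<le> dist w y"
  using gromov_product_le_dist1[of w y x] by (simp add: gromov_product_commute)

lemma gromov_product_change_base: "gromov_product w x y \<le> gromov_product w' x y + dist w w'"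
  using dist_triangle[of w x w'] dist_triangle[of w y w'] unfolding gromov_product_def by argo

lemma gromov_product_isometry:
  "isometry g \<Longrightarrow> gromov_product (g w) (g x) (g y) = gromov_product w x y"
  by (simp add: gromov_product_def isometry_def)

lemma gromov_product_isometry_le:
  assumes "isometry g"
  shows "gromov_product b x y \<le> gromov_product b (g x) (g y) + dist (g b) b"
  using gromov_product_change_base[of "g b" "g x" "g y" b] gromov_product_isometry[OF assms, of b x y]
  by simp

lemma gromov_product_trans:
  assumes "gromov_hyperbolic \<delta> TYPE('h::metric_space)"
    and "R \<le> gromov_product w x y" "R \<le> gromov_product w y (z::'h)"
  shows "R - \<delta> \<le> gromov_product w x z"
  using assms unfolding gromov_hyperbolic_def
  by (smt (verit))

lemma isometry_comp: "isometry g \<Longrightarrow> isometry h \<Longrightarrow> isometry (g \<circ> h)"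
  by (auto simp: isometry_def bij_comp)

lemma isometry_id: "isometry id"
  by (simp add: isometry_def)

lemma isometry_dist_inv:
  assumes "isometry g" shows "dist x (inv g y) = dist (g x) y"
proof -
  have "g (inv g y) = y"
    using assms by (simp add: isometry_def bij_is_surj surj_f_inv_f)
  moreover have "dist (g x) (g (inv g y)) = dist x (inv g y)"
    using assms by (simp add: isometry_def)
  ultimately show ?thesis by simp
qed

section \<open>Path laws\<close>

lemma length_path_pmf: "zs \<in> set_pmf (path_pmf P n x) \<Longrightarrow> length zs = n"
  by (induction n arbitrary: x zs) auto

text \<open>Markov property: after \<open>us\<close> the chain restarts from its current state,
  which \<open>last (x # us)\<close> yields even when \<open>us\<close> is empty.\<close>

lemma path_pmf_append:
  "path_pmf P (m + n) x =
     bind_pmf (path_pmf P m x) (\<lambda>us. map_pmf ((@) us) (path_pmf P n (last (x # us))))"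
proof (induction m arbitrary: x)
  case 0
  then show ?case by (simp add: bind_return_pmf map_pmf_def bind_return_pmf')
next
  case (Suc m)
  have *: "map_pmf (Cons y) (path_pmf P (m + n) y) =
     bind_pmf (path_pmf P m y) (\<lambda>us. map_pmf ((@) (y # us)) (path_pmf P n (last (y # us))))" for y
    by (simp add: Suc map_bind_pmf map_pmf_comp o_def fun_eq_iff cong: map_pmf_cong)
  show ?case
    by (simp add: * bind_assoc_pmf bind_map_pmf del: append_Cons)
qed

text \<open>Laws of finite paths are consistent, so events at several times can be compared under
  the law of one long path, without a measure on infinite paths.\<close>

lemma take_path_pmf: "map_pmf (take m) (path_pmf P (m + k) x) = path_pmf P m x"
proof -
  have "map_pmf (take m) (path_pmf P (m + k) x) =
     bind_pmf (path_pmf P m x) (\<lambda>us. map_pmf (\<lambda>vs. take m (us @ vs)) (path_pmf P k (last (x # us))))"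
    by (simp add: path_pmf_append map_bind_pmf map_pmf_comp)
  also have "\<dots> = bind_pmf (path_pmf P m x) (\<lambda>us. map_pmf (\<lambda>vs. us) (path_pmf P k (last (x # us))))"
    by (intro bind_pmf_cong refl map_pmf_cong) (auto dest: length_path_pmf)
  also have "\<dots> = path_pmf P m x"
    by (simp add: map_pmf_const bind_return_pmf')
  finally show ?thesis .
qed

lemma take_path_pmf': "m \<le> n \<Longrightarrow> map_pmf (take m) (path_pmf P n x) = path_pmf P m x"
  using take_path_pmf[of m P "n - m" x] by simp

lemma last_path_pmf: "map_pmf (\<lambda>us. last (x # us)) (path_pmf P n x) = kernel_pow P n x"
proof (induction n arbitrary: x)
  case (Suc n)
  have "map_pmf (\<lambda>us. last (x # us)) (path_pmf P (Suc n) x) =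
     bind_pmf (P x) (\<lambda>y. map_pmf (\<lambda>us. last (y # us)) (path_pmf P n y))"
    by (simp add: map_bind_pmf map_pmf_comp o_def)
  then show ?case unfolding Suc by simp
qed simp

lemma walk_prod_append: "walk_prod X (us @ vs) = walk_prod X vs \<circ> walk_prod X us"
proof -
  have *: "foldl (\<lambda>g z. X z \<circ> g) h vs = foldl (\<lambda>g z. X z \<circ> g) id vs \<circ> h" for h
  proof (induction vs rule: rev_induct)
    case (snoc v vs)
    then show ?case by (simp add: comp_assoc)
  qed simp
  show ?thesis
    unfolding walk_prod_def foldl_append by (rule *)
qed

lemma walk_prod_Nil [simp]: "walk_prod X [] = id"
  by (simp add: walk_prod_def)

lemma walk_prod_Cons: "walk_prod X (z # zs) = walk_prod X zs \<circ> X z"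
  using walk_prod_append[of X "[z]" zs] by (simp add: walk_prod_def)

lemma isometry_walk_prod: "(\<And>x. isometry (X x)) \<Longrightarrow> isometry (walk_prod X zs)"
  by (induction zs) (auto simp: isometry_id walk_prod_Cons intro: isometry_comp)

lemma nn_integral_path_append:
  "(\<integral>\<^sup>+zs. f zs \<partial>path_pmf P (m + n) x) =
   (\<integral>\<^sup>+us. (\<integral>\<^sup>+vs. f (us @ vs) \<partial>path_pmf P n (last (x # us))) \<partial>path_pmf P m x)"
  by (simp add: path_pmf_append)

lemma nn_integral_last_path:
  "(\<integral>\<^sup>+us. f (last (x # us)) \<partial>path_pmf P n x) = (\<integral>\<^sup>+z. f z \<partial>kernel_pow P n x)"
  by (simp add: last_path_pmf[symmetric])

section \<open>Displacement cocycle and exponential moments\<close>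

text \<open>Taylor bound of second order. The linear term will carry the drift, and a small exponent
  will make the quadratic term negligible.\<close>

lemma exp_le_quadratic:
  fixes v :: real
  shows "exp v \<le> 1 + v + v\<^sup>2 * exp \<bar>v\<bar>"
proof -
  obtain t where t: "\<bar>t\<bar> \<le> \<bar>v\<bar>" "exp v = (\<Sum>m<2. v ^ m / fact m) + exp t / fact 2 * v ^ 2"
    using Maclaurin_exp_le[of v 2] by auto
  have "exp t / 2 * v\<^sup>2 \<le> exp \<bar>v\<bar> * v\<^sup>2"
  proof (intro mult_right_mono)
    have "exp t \<le> exp \<bar>v\<bar>" using t(1) by simp
    then show "exp t / 2 \<le> exp \<bar>v\<bar>" using exp_ge_zero[of t] by linarith
  qed simp
  then show ?thesis
    using t(2) by (simp add: numeral_2_eq_2 mult.commute)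
qed

lemma square_le_exp:
  fixes v :: real
  assumes "0 \<le> v" shows "v\<^sup>2 \<le> 2 * exp v"
  using exp_lower_Taylor_quadratic[OF assms] assms by simp

text \<open>The constants of the moment condition are fixed here; with \<open>1 \<le> B\<close> the
  bounds \<open>B ^ n\<close> increase with \<open>n\<close>, which absorbs incomplete
  blocks.\<close>

locale isometric_walk =
  fixes P :: "'e::countable \<Rightarrow> 'e pmf"
    and X :: "'e \<Rightarrow> ('h::metric_space \<Rightarrow> 'h)"
    and b :: 'h
    and a B :: real
  assumes isom: "isometry (X x)"
    and a_pos: "0 < a"
    and B_ge_1: "1 \<le> B"
    and exp_moment: "(\<integral>\<^sup>+ y. ennreal (exp (a * dist (X y b) b)) \<partial>measure_pmf (P x)) \<le> ennreal B"
begin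

abbreviation M :: "'e list \<Rightarrow> 'h \<Rightarrow> 'h" where
  "M \<equiv> walk_prod X"

definition kap :: "'e list \<Rightarrow> real" where
  "kap zs = dist (M zs b) b"

definition disp :: "'h \<Rightarrow> 'e list \<Rightarrow> real" where
  "disp w zs = dist (M zs w) b - dist w b"

text \<open>In \<open>inv (M zs) b\<close> the factor of a new step stands next to \<open>b\<close>,
  so successive values are one step length apart and the sequence can converge at infinity.\<close>

definition Y :: "'e list \<Rightarrow> 'h" where
  "Y zs = inv (M zs) b"

abbreviation gp :: "'h \<Rightarrow> 'h \<Rightarrow> real" where
  "gp \<equiv> gromov_product b"

lemma isometry_M: "isometry (M zs)"
  by (rule isometry_walk_prod) (rule isom)

lemma dist_M: "dist (M zs v) (M zs w) = dist v w"
  using isometry_M[of zs] by (simp add: isometry_def)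

lemma kap_nonneg [simp]: "0 \<le> kap zs"
  by (simp add: kap_def)

lemma kap_append: "kap (us @ vs) \<le> kap us + kap vs"
  using dist_triangle[of "M vs (M us b)" b "M vs b"] by (simp add: kap_def walk_prod_append dist_M)

lemma kap_suffix_le: "kap vs \<le> kap us + kap (us @ vs)"
  using dist_triangle[of "M vs b" b "M vs (M us b)"]
  by (simp add: kap_def walk_prod_append dist_M dist_commute)

text \<open>Cocycle identity. The second part of the path sees the moved point
  \<open>M us w\<close>, which is why every drift estimate below is uniform in
  \<open>w\<close>.\<close>

lemma disp_append: "disp w (us @ vs) = disp w us + disp (M us w) vs"
  by (simp add: disp_def walk_prod_append)

lemma abs_disp_le: "\<bar>disp w zs\<bar> \<le> kap zs"
proof -
  have "dist (M zs w) b \<le> dist w b + kap zs"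
    using dist_triangle[of "M zs w" b "M zs b"] by (simp add: kap_def dist_M)
  moreover have "dist w b \<le> dist (M zs w) b + kap zs"
    using dist_triangle[of "M zs w" "M zs b" b] by (simp add: kap_def dist_M dist_commute)
  ultimately show ?thesis
    by (simp add: disp_def)
qed

lemma disp_base: "disp b zs = kap zs"
  by (simp add: disp_def kap_def)

lemma dist_Y: "dist w (Y zs) = dist (M zs w) b"
  unfolding Y_def by (rule isometry_dist_inv) (rule isometry_M)

lemma M_Y: "M zs (Y zs) = b"
  using dist_Y[of "Y zs" zs] by simp

lemma M_Y_append: "M us (Y (us @ vs)) = Y vs"
proof -
  have "M vs (M us (Y (us @ vs))) = b"
    using M_Y[of "us @ vs"] by (simp add: walk_prod_append)
  then have "dist (M us (Y (us @ vs))) (Y vs) = 0"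
    by (simp add: dist_Y)
  then show ?thesis by simp
qed

lemma dist_b_Y: "dist b (Y zs) = kap zs"
  by (simp add: dist_Y kap_def)

lemma dist_Y_Y_append: "dist (Y us) (Y (us @ vs)) = kap vs"
  using dist_M[of us "Y us" "Y (us @ vs)"] by (simp add: M_Y M_Y_append dist_b_Y)

text \<open>The shortfall of the displacement of \<open>w\<close> against that of \<open>b\<close>
  is twice a Gromov product; a lower drift bound thus amounts to \<open>w\<close> and the inverse
  walk rarely pointing the same way.\<close>

lemma gp_Y: "gp w (Y zs) = (kap zs - disp w zs) / 2"
  by (simp add: gromov_product_def dist_b_Y dist_Y disp_def kap_def dist_commute[of b w])

text \<open>As \<open>Y us\<close> and \<open>Y (us @ vs)\<close> are \<open>kap vs\<close> apart,
  only the lengths of a path, a prefix and a suffix enter, and their means are known under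
  stationarity.\<close>

lemma gp_Y_append: "gp (Y us) (Y (us @ vs)) = (kap us + kap (us @ vs) - kap vs) / 2"
  by (simp add: gromov_product_def dist_b_Y dist_Y_Y_append)

text \<open>Applying \<open>M us\<close> strips the prefix from the inverse walk and moves the base
  point by \<open>kap us\<close>.\<close>

lemma gp_Y_append_le: "gp w (Y (us @ vs)) \<le> gp (M us w) (Y vs) + kap us"
  using gromov_product_isometry_le[OF isometry_M[of us], of b w "Y (us @ vs)"]
  by (simp add: M_Y_append kap_def)

lemma gp_Y_le: "gp w (Y zs) \<le> kap zs"
  using gromov_product_le_dist2[of b w "Y zs"] by (simp add: dist_b_Y)

text \<open>Subadditivity of \<open>kap\<close> turns the exponential into a product, and the Markov
  property bounds each step by a factor \<open>B\<close>.\<close>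

lemma nn_integral_exp_kap:
  "(\<integral>\<^sup>+zs. ennreal (exp (a * kap zs)) \<partial>path_pmf P n x) \<le> ennreal (B ^ n)"
proof (induction n arbitrary: x)
  case 0
  then show ?case by (simp add: kap_def)
next
  case (Suc n)
  have "(\<integral>\<^sup>+zs. ennreal (exp (a * kap zs)) \<partial>path_pmf P (Suc n) x) =
      (\<integral>\<^sup>+y. (\<integral>\<^sup>+zs. ennreal (exp (a * kap (y # zs))) \<partial>path_pmf P n y) \<partial>P x)"
    by simp
  also have "\<dots> \<le> (\<integral>\<^sup>+y. (\<integral>\<^sup>+zs. ennreal (exp (a * dist (X y b) b)) *
      ennreal (exp (a * kap zs)) \<partial>path_pmf P n y) \<partial>P x)"
  proof (intro nn_integral_mono)
    fix y zs
    have "kap (y # zs) \<le> dist (X y b) b + kap zs"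
      using kap_append[of "[y]" zs] by (simp add: kap_def walk_prod_def)
    then have "exp (a * kap (y # zs)) \<le> exp (a * dist (X y b) b) * exp (a * kap zs)"
      using a_pos by (simp flip: exp_add distrib_left)
    then show "ennreal (exp (a * kap (y # zs))) \<le> ennreal (exp (a * dist (X y b) b)) * ennreal (exp (a * kap zs))"
      by (simp flip: ennreal_mult add: ennreal_leI)
  qed
  also have "\<dots> \<le> (\<integral>\<^sup>+y. ennreal (exp (a * dist (X y b) b)) * ennreal (B ^ n) \<partial>P x)"
    by (intro nn_integral_mono) (simp add: nn_integral_cmult mult_left_mono Suc)
  also have "\<dots> = (\<integral>\<^sup>+y. ennreal (exp (a * dist (X y b) b)) \<partial>P x) * ennreal (B ^ n)"
    by (rule nn_integral_multc) simp
  also have "\<dots> \<le> ennreal B * ennreal (B ^ n)"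
    by (intro mult_right_mono exp_moment) simp
  also have "\<dots> = ennreal (B ^ Suc n)"
    using B_ge_1 by (simp flip: ennreal_mult)
  finally show ?case .
qed

lemma integrable_exp_kap: "integrable (path_pmf P n x) (\<lambda>zs. exp (a * kap zs))"
  and expectation_exp_kap: "measure_pmf.expectation (path_pmf P n x) (\<lambda>zs. exp (a * kap zs)) \<le> B ^ n"
proof -
  show *: "integrable (path_pmf P n x) (\<lambda>zs. exp (a * kap zs))"
    using nn_integral_exp_kap[of n x]
    by (intro integrableI_nonneg) (auto simp: less_top[symmetric] top_unique)
  show "measure_pmf.expectation (path_pmf P n x) (\<lambda>zs. exp (a * kap zs)) \<le> B ^ n"
    using nn_integral_exp_kap[of n x] nn_integral_eq_integral[OF *] B_ge_1 by simp
qed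

lemma kap_le_exp: "kap zs \<le> exp (a * kap zs) / a"
proof -
  have "a * kap zs \<le> exp (a * kap zs)"
    using exp_ge_add_one_self[of "a * kap zs"] by linarith
  then show ?thesis
    using a_pos by (simp add: field_simps)
qed

lemma integrable_kap: "integrable (path_pmf P n x) kap"
proof (rule Bochner_Integration.integrable_bound)
  show "integrable (path_pmf P n x) (\<lambda>zs. exp (a * kap zs) / a)"
    by (intro integrable_divide integrable_exp_kap)
qed (use kap_le_exp a_pos in auto)

lemma integrable_disp: "integrable (path_pmf P n x) (disp w)"
  by (rule Bochner_Integration.integrable_bound[OF integrable_kap]) (use abs_disp_le in auto)

section \<open>Chernoff bounds from a uniform drift\<close>

text \<open>To first order in \<open>s\<close> the moment is \<open>1 + s * N * r\<close>; the gap
  between \<open>r\<close> and \<open>r'\<close> pays for the term of second order. The sign of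
  \<open>t\<close> selects the upper or the lower tail.\<close>

lemma exp_moment_block:
  fixes t r r' :: real
  assumes N: "N \<ge> 1" and t: "\<bar>t\<bar> \<le> 1" and r: "r < r'"
    and drift: "\<And>x w. t * measure_pmf.expectation (path_pmf P N x) (disp w) \<le> real N * r"
  obtains s where "0 < s" "s \<le> a"
    "\<And>x w. (\<integral>\<^sup>+zs. ennreal (exp (s * (t * disp w zs))) \<partial>path_pmf P N x) \<le> ennreal (exp (s * real N * r'))"
proof -
  \<comment> \<open>\<open>s \<le> a / 2\<close> keeps half of the exponent
    \<open>a * kap zs\<close> for absorbing the square \<open>(a / 2 * kap zs)\<^sup>2\<close>,
    hence the factor 8. The other bound on \<open>s\<close> makes the quadratic error
    \<open>s\<^sup>2 * K\<close> at most \<open>s * N * (r' - r)\<close>.\<close>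
  define K where "K = 8 / a\<^sup>2 * B ^ N"
  define s where "s = min (a / 2) (real N * (r' - r) / K)"
  have K: "0 < K" using a_pos B_ge_1 by (simp add: K_def)
  have s: "0 < s" "s \<le> a / 2" "s * K \<le> real N * (r' - r)"
    using a_pos K N r by (auto simp: s_def min_def field_simps)
  have *: "(\<integral>\<^sup>+zs. ennreal (exp (s * (t * disp w zs))) \<partial>path_pmf P N x) \<le> ennreal (exp (s * real N * r'))" for x w
  proof -
    let ?E = "measure_pmf.expectation (path_pmf P N x)"
    have pt: "exp (s * (t * disp w zs)) \<le> 1 + s * t * disp w zs + s\<^sup>2 * (8 / a\<^sup>2) * exp (a * kap zs)" for zs
    proof -
      let ?v = "s * (t * disp w zs)"
      have v1: "\<bar>t * disp w zs\<bar> \<le> kap zs"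
        using mult_mono[OF t abs_disp_le[of w zs]] by (simp add: abs_mult)
      then have v: "\<bar>?v\<bar> \<le> s * kap zs"
        using s by (simp add: abs_mult[of s])
      have "?v\<^sup>2 \<le> (s * kap zs)\<^sup>2"
        using v by (metis abs_ge_zero power2_abs power_mono)
      moreover have "exp \<bar>?v\<bar> \<le> exp (a / 2 * kap zs)"
        using v mult_right_mono[OF s(2), of "kap zs"] by simp
      ultimately have "?v\<^sup>2 * exp \<bar>?v\<bar> \<le> (s * kap zs)\<^sup>2 * exp (a / 2 * kap zs)"
        by (intro mult_mono) auto
      also have "\<dots> = s\<^sup>2 * (4 / a\<^sup>2) * ((a / 2 * kap zs)\<^sup>2 * exp (a / 2 * kap zs))"
        using a_pos by (simp add: power_mult_distrib power_divide)
      also have "\<dots> \<le> s\<^sup>2 * (4 / a\<^sup>2) * ((2 * exp (a / 2 * kap zs)) * exp (a / 2 * kap zs))"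
        using a_pos by (intro mult_left_mono mult_right_mono square_le_exp) auto
      also have "\<dots> = s\<^sup>2 * (8 / a\<^sup>2) * exp (a * kap zs)"
        by (simp flip: exp_add)
      finally show ?thesis
        using exp_le_quadratic[of ?v] by (simp add: mult.assoc)
    qed
    have int: "integrable (path_pmf P N x) (\<lambda>zs. 1 + s * t * disp w zs + s\<^sup>2 * (8 / a\<^sup>2) * exp (a * kap zs))"
      by (intro Bochner_Integration.integrable_add integrable_mult_right integrable_disp integrable_exp_kap) simp
    have nn: "0 \<le> 1 + s * t * disp w zs + s\<^sup>2 * (8 / a\<^sup>2) * exp (a * kap zs)" for zs
      using pt[of zs] exp_ge_zero order_trans by blast
    have "(\<integral>\<^sup>+zs. ennreal (exp (s * (t * disp w zs))) \<partial>path_pmf P N x) \<le>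
        (\<integral>\<^sup>+zs. ennreal (1 + s * t * disp w zs + s\<^sup>2 * (8 / a\<^sup>2) * exp (a * kap zs)) \<partial>path_pmf P N x)"
      by (intro nn_integral_mono ennreal_leI pt)
    also have "\<dots> = ennreal (?E (\<lambda>zs. 1 + s * t * disp w zs + s\<^sup>2 * (8 / a\<^sup>2) * exp (a * kap zs)))"
      by (intro nn_integral_eq_integral int) (use nn in auto)
    also have "?E (\<lambda>zs. 1 + s * t * disp w zs + s\<^sup>2 * (8 / a\<^sup>2) * exp (a * kap zs)) =
        1 + s * t * ?E (disp w) + s\<^sup>2 * (8 / a\<^sup>2) * ?E (\<lambda>zs. exp (a * kap zs))"
      by (simp add: integrable_disp integrable_exp_kap)
    also have "\<dots> \<le> 1 + s * (real N * r) + s * (s * K)"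
    proof -
      have "s * t * ?E (disp w) \<le> s * (real N * r)"
        using mult_left_mono[OF drift[of x w], of s] s by (simp add: mult.assoc)
      moreover have "s\<^sup>2 * (8 / a\<^sup>2) * ?E (\<lambda>zs. exp (a * kap zs)) \<le> s\<^sup>2 * (8 / a\<^sup>2) * B ^ N"
        by (intro mult_left_mono expectation_exp_kap) auto
      ultimately show ?thesis by (simp add: K_def power2_eq_square mult.assoc)
    qed
    also have "\<dots> \<le> 1 + s * (real N * r) + s * (real N * (r' - r))"
      using s by (intro add_left_mono mult_left_mono) auto
    also have "\<dots> = 1 + s * real N * r'"
      by (simp add: algebra_simps)
    also have "\<dots> \<le> exp (s * real N * r')"
      by (rule exp_ge_add_one_self)
    finally show ?thesis
      by (simp add: ennreal_leI)
  qed
  show ?thesis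
    by (rule that[of s]) (use s a_pos * in auto)
qed

lemma exp_moment_drift:
  fixes t r r' :: real
  assumes N: "N \<ge> 1" and t: "\<bar>t\<bar> \<le> 1" and r: "r < r'"
    and drift: "\<And>x w. t * measure_pmf.expectation (path_pmf P N x) (disp w) \<le> real N * r"
  obtains s K where "0 < s" "0 < K"
    "\<And>x w n. (\<integral>\<^sup>+zs. ennreal (exp (s * (t * disp w zs))) \<partial>path_pmf P n x) \<le> ennreal (K * exp (s * real n * r'))"
proof -
  obtain s where s: "0 < s" "s \<le> a" and
    block: "\<And>x w. (\<integral>\<^sup>+zs. ennreal (exp (s * (t * disp w zs))) \<partial>path_pmf P N x) \<le> ennreal (exp (s * real N * r'))"
    using exp_moment_block[OF N t r drift] by metis
  define q where "q = exp (s * real N * r')"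
  \<comment> \<open>Blocks are removed from the front: the block bound is uniform in
    \<open>x\<close> and \<open>w\<close>, so it applies again at the new state and at the moved
    point. The last \<open>j\<close> steps are only bounded crudely, using
    \<open>s \<le> a\<close>.\<close>
  have iter: "(\<integral>\<^sup>+zs. ennreal (exp (s * (t * disp w zs))) \<partial>path_pmf P (k * N + j) x) \<le> ennreal (q ^ k * B ^ j)" for x w k j
  proof (induction k arbitrary: x w)
    case 0
    have "exp (s * (t * disp w zs)) \<le> exp (a * kap zs)" for zs
    proof -
      have "\<bar>t * disp w zs\<bar> \<le> kap zs"
        using mult_mono[OF t abs_disp_le[of w zs]] by (simp add: abs_mult)
      then have "s * (t * disp w zs) \<le> a * kap zs"
        using s by (intro order_trans[OF mult_left_mono[of "t * disp w zs" "kap zs" s]] mult_right_mono) auto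
      then show ?thesis by simp
    qed
    then have "(\<integral>\<^sup>+zs. ennreal (exp (s * (t * disp w zs))) \<partial>path_pmf P j x) \<le>
      (\<integral>\<^sup>+zs. ennreal (exp (a * kap zs)) \<partial>path_pmf P j x)"
      by (intro nn_integral_mono ennreal_leI)
    then show ?case
      using nn_integral_exp_kap[of j x] by (simp add: order_trans)
  next
    case (Suc k)
    have "(\<integral>\<^sup>+zs. ennreal (exp (s * (t * disp w zs))) \<partial>path_pmf P (Suc k * N + j) x) =
        (\<integral>\<^sup>+us. (\<integral>\<^sup>+vs. ennreal (exp (s * (t * disp w (us @ vs)))) \<partial>path_pmf P (k * N + j) (last (x # us))) \<partial>path_pmf P N x)"
      using nn_integral_path_append[where P=P and m=N and n="k * N + j" and x=x] by (simp add: add.assoc)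
    also have "\<dots> = (\<integral>\<^sup>+us. (\<integral>\<^sup>+vs. ennreal (exp (s * (t * disp w us))) * ennreal (exp (s * (t * disp (M us w) vs)))
         \<partial>path_pmf P (k * N + j) (last (x # us))) \<partial>path_pmf P N x)"
      by (simp add: disp_append distrib_left exp_add ennreal_mult)
    also have "\<dots> \<le> (\<integral>\<^sup>+us. ennreal (exp (s * (t * disp w us))) * ennreal (q ^ k * B ^ j) \<partial>path_pmf P N x)"
      by (intro nn_integral_mono) (auto simp: nn_integral_cmult simp del: last.simps intro!: mult_left_mono Suc)
    also have "\<dots> = (\<integral>\<^sup>+us. ennreal (exp (s * (t * disp w us))) \<partial>path_pmf P N x) * ennreal (q ^ k * B ^ j)"
      by (rule nn_integral_multc) simp
    also have "\<dots> \<le> ennreal q * ennreal (q ^ k * B ^ j)"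
      using block[of x w] by (intro mult_right_mono) (auto simp: q_def)
    also have "\<dots> = ennreal (q ^ Suc k * B ^ j)"
      using B_ge_1 by (simp add: q_def mult.assoc flip: ennreal_mult)
    finally show ?case .
  qed
  \<comment> \<open>The first factor corrects the exponent from \<open>k * N\<close> steps to
    \<open>n\<close> steps whatever the sign of \<open>r'\<close>; the second covers the incomplete
    block.\<close>
  define K where "K = exp (s * real N * \<bar>r'\<bar>) * B ^ N"
  have "(\<integral>\<^sup>+zs. ennreal (exp (s * (t * disp w zs))) \<partial>path_pmf P n x) \<le> ennreal (K * exp (s * real n * r'))" for x w n
  proof -
    define k j where "k = n div N" and "j = n mod N"
    have n: "n = k * N + j" and j: "j < N"
      using N by (auto simp: k_def j_def)
    have "q ^ k = exp (s * real (k * N) * r')"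
      by (simp add: q_def exp_of_nat_mult[symmetric] algebra_simps)
    also have "\<dots> = exp (s * real n * r') * exp (- (s * real j * r'))"
      by (simp add: n algebra_simps flip: exp_add)
    also have "\<dots> \<le> exp (s * real n * r') * exp (s * real N * \<bar>r'\<bar>)"
    proof -
      have "- (s * real j * r') \<le> s * real j * \<bar>r'\<bar>"
        using s by (metis abs_ge_minus_self abs_mult abs_of_nat abs_of_pos)
      also have "\<dots> \<le> s * real N * \<bar>r'\<bar>"
        using s j by (intro mult_right_mono mult_left_mono) auto
      finally show ?thesis by simp
    qed
    finally have "q ^ k * B ^ j \<le> exp (s * real n * r') * exp (s * real N * \<bar>r'\<bar>) * B ^ N"
      using j B_ge_1 by (intro mult_mono power_increasing) auto
    then show ?thesis
      using iter[where w=w and k=k and j=j and x=x] unfolding n[symmetric]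
      by (auto simp: K_def ac_simps intro: order_trans ennreal_leI)
  qed
  moreover have "0 < K"
    using B_ge_1 by (simp add: K_def)
  ultimately show ?thesis
    using that[of s K] s by auto
qed

text \<open>Markov's inequality for the exponential. The moment grows at a rate \<open>r1\<close>
  strictly below \<open>r'\<close>, and the gap gives the exponent of decay.\<close>

lemma large_deviation_drift:
  fixes t r r' :: real
  assumes N: "N \<ge> 1" and t: "\<bar>t\<bar> \<le> 1" and r: "r < r'"
    and drift: "\<And>x w. t * measure_pmf.expectation (path_pmf P N x) (disp w) \<le> real N * r"
  obtains \<alpha> K where "0 < \<alpha>" "0 < K"
    "\<And>x w n. measure_pmf.prob (path_pmf P n x) {zs. real n * r' \<le> t * disp w zs} \<le> K * exp (- \<alpha> * real n)"
proof -
  define r1 where "r1 = (r + r') / 2"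
  have r1: "r < r1" "r1 < r'" using r by (auto simp: r1_def)
  obtain s K where s: "0 < s" "0 < K" and
    le: "\<And>x w n. (\<integral>\<^sup>+zs. ennreal (exp (s * (t * disp w zs))) \<partial>path_pmf P n x) \<le> ennreal (K * exp (s * real n * r1))"
    using exp_moment_drift[OF N t r1(1) drift] by metis
  have "measure_pmf.prob (path_pmf P n x) {zs. real n * r' \<le> t * disp w zs} \<le> K * exp (- (s * (r' - r1)) * real n)" for n x w
  proof -
    let ?A = "{zs. real n * r' \<le> t * disp w zs}"
    have "ennreal (exp (s * real n * r')) * emeasure (path_pmf P n x) ?A =
      (\<integral>\<^sup>+zs. ennreal (exp (s * real n * r')) * indicator ?A zs \<partial>path_pmf P n x)"
      by (rule nn_integral_cmult_indicator[symmetric]) simp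
    also have "\<dots> \<le> (\<integral>\<^sup>+zs. ennreal (exp (s * (t * disp w zs))) \<partial>path_pmf P n x)"
      using s by (intro nn_integral_mono) (auto simp: indicator_def mult.assoc)
    also have "\<dots> \<le> ennreal (K * exp (s * real n * r1))"
      by (rule le)
    finally have "exp (s * real n * r') * measure_pmf.prob (path_pmf P n x) ?A \<le> K * exp (s * real n * r1)"
      using s by (simp add: measure_pmf.emeasure_eq_measure flip: ennreal_mult)
    then have "measure_pmf.prob (path_pmf P n x) ?A \<le> K * exp (s * real n * r1) / exp (s * real n * r')"
      by (simp add: field_simps)
    also have "\<dots> = K * exp (- (s * (r' - r1)) * real n)"
      by (simp add: exp_diff algebra_simps)
    finally show ?thesis .
  qed
  then show ?thesis
    using that[of "s * (r' - r1)" K] s r1 by auto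
qed

end

section \<open>Total variation and subadditivity\<close>

lemma bdd_above_tv: "bdd_above (range (\<lambda>A. \<bar>measure_pmf.prob \<mu> A - measure_pmf.prob \<nu> A\<bar>))"
proof (rule bdd_aboveI[of _ 1])
  fix t assume "t \<in> range (\<lambda>A. \<bar>measure_pmf.prob \<mu> A - measure_pmf.prob \<nu> A\<bar>)"
  then obtain A where "t = \<bar>measure_pmf.prob \<mu> A - measure_pmf.prob \<nu> A\<bar>" by auto
  then show "t \<le> 1"
    using measure_pmf.prob_le_1[of \<mu> A] measure_pmf.prob_le_1[of \<nu> A]
      measure_nonneg[of \<mu> A] measure_nonneg[of \<nu> A] by linarith
qed

lemma prob_diff_le_tv: "measure_pmf.prob \<mu> A - measure_pmf.prob \<nu> A \<le> tv_dist \<mu> \<nu>"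
proof -
  have "\<bar>measure_pmf.prob \<mu> A - measure_pmf.prob \<nu> A\<bar> \<le> tv_dist \<mu> \<nu>"
    unfolding tv_dist_def by (rule cSUP_upper[OF _ bdd_above_tv]) simp
  then show ?thesis by linarith
qed

lemma tv_dist_commute: "tv_dist \<mu> \<nu> = tv_dist \<nu> \<mu>"
  by (simp add: tv_dist_def abs_minus_commute)

text \<open>On the set where \<open>\<mu>\<close> dominates \<open>\<nu>\<close> the excess mass is
  a difference of probabilities of one set, hence at most \<open>tv_dist\<close>; elsewhere
  replacing \<open>\<mu>\<close> by \<open>\<nu>\<close> only increases the integral.\<close>

lemma nn_integral_le_tv:
  fixes f :: "'e \<Rightarrow> ennreal"
  assumes "\<And>x. f x \<le> ennreal K" "0 \<le> K"
  shows "(\<integral>\<^sup>+x. f x \<partial>measure_pmf \<mu>) \<le> (\<integral>\<^sup>+x. f x \<partial>measure_pmf \<nu>) + ennreal (K * tv_dist \<mu> \<nu>)"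
proof -
  define A where "A = {x. pmf \<nu> x \<le> pmf \<mu> x}"
  have tv0: "0 \<le> tv_dist \<mu> \<nu>"
    using prob_diff_le_tv[of \<mu> "{}" \<nu>] by simp
  have pt: "ennreal (pmf \<mu> x) * f x \<le> ennreal (pmf \<nu> x) * f x +
      ennreal K * ((ennreal (pmf \<mu> x) - ennreal (pmf \<nu> x)) * indicator A x)" for x
  proof (cases "x \<in> A")
    case True
    have "ennreal (pmf \<mu> x) = ennreal (pmf \<nu> x) + (ennreal (pmf \<mu> x) - ennreal (pmf \<nu> x))"
      using True by (simp add: A_def ennreal_minus flip: ennreal_plus)
    then have "ennreal (pmf \<mu> x) * f x = ennreal (pmf \<nu> x) * f x + f x * (ennreal (pmf \<mu> x) - ennreal (pmf \<nu> x))"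
      by (metis distrib_right mult.commute)
    also have "\<dots> \<le> ennreal (pmf \<nu> x) * f x + ennreal K * (ennreal (pmf \<mu> x) - ennreal (pmf \<nu> x))"
      by (intro add_left_mono mult_right_mono assms) simp
    finally show ?thesis using True by simp
  next
    case False
    then show ?thesis by (auto simp: A_def intro!: mult_right_mono)
  qed
  have "(\<integral>\<^sup>+x. (ennreal (pmf \<mu> x) - ennreal (pmf \<nu> x)) * indicator A x \<partial>count_space UNIV) =
      (\<integral>\<^sup>+x. ennreal (pmf \<mu> x) - ennreal (pmf \<nu> x) \<partial>count_space A)"
    by (rule nn_integral_count_space_indicator[symmetric]) simp
  also have "\<dots> = (\<integral>\<^sup>+x. ennreal (pmf \<mu> x) \<partial>count_space A) - (\<integral>\<^sup>+x. ennreal (pmf \<nu> x) \<partial>count_space A)"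
    by (intro nn_integral_diff) (auto simp: nn_integral_pmf A_def AE_count_space)
  also have "\<dots> = ennreal (measure_pmf.prob \<mu> A - measure_pmf.prob \<nu> A)"
    by (simp add: nn_integral_pmf measure_pmf.emeasure_eq_measure ennreal_minus)
  also have "\<dots> \<le> ennreal (tv_dist \<mu> \<nu>)"
    by (intro ennreal_leI prob_diff_le_tv)
  finally have tv: "(\<integral>\<^sup>+x. (ennreal (pmf \<mu> x) - ennreal (pmf \<nu> x)) * indicator A x \<partial>count_space UNIV) \<le> ennreal (tv_dist \<mu> \<nu>)" .
  have "(\<integral>\<^sup>+x. f x \<partial>measure_pmf \<mu>) = (\<integral>\<^sup>+x. ennreal (pmf \<mu> x) * f x \<partial>count_space UNIV)"
    by (rule nn_integral_measure_pmf)
  also have "\<dots> \<le> (\<integral>\<^sup>+x. ennreal (pmf \<nu> x) * f x +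
      ennreal K * ((ennreal (pmf \<mu> x) - ennreal (pmf \<nu> x)) * indicator A x) \<partial>count_space UNIV)"
    by (intro nn_integral_mono pt)
  also have "\<dots> = (\<integral>\<^sup>+x. f x \<partial>measure_pmf \<nu>) +
      ennreal K * (\<integral>\<^sup>+x. (ennreal (pmf \<mu> x) - ennreal (pmf \<nu> x)) * indicator A x \<partial>count_space UNIV)"
    by (subst nn_integral_add) (auto simp: nn_integral_cmult nn_integral_measure_pmf)
  also have "\<dots> \<le> (\<integral>\<^sup>+x. f x \<partial>measure_pmf \<nu>) + ennreal K * ennreal (tv_dist \<mu> \<nu>)"
    by (intro add_left_mono mult_left_mono tv) simp
  finally show ?thesis
    using assms tv0 by (simp add: ennreal_mult)
qed

lemma nn_integral_pmf_le_const:
  "(\<And>x. f x \<le> c) \<Longrightarrow> (\<integral>\<^sup>+x. f x \<partial>measure_pmf p) \<le> (c::ennreal)"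
  using nn_integral_mono[of p f "\<lambda>_. c"] by simp

lemma subadditive_mult_add:
  fixes u :: "nat \<Rightarrow> real"
  assumes "\<And>m n. u (m + n) \<le> u m + u n"
  shows "u (q * k + j) \<le> real q * u k + u j"
proof (induction q)
  case (Suc q)
  have "u (Suc q * k + j) \<le> u k + u (q * k + j)"
    using assms[of k "q * k + j"] by (simp add: add.assoc)
  then show ?case using Suc by (simp add: algebra_simps)
qed simp

text \<open>Upper half of Fekete's lemma: choose \<open>k\<close> nearly attaining the infimum and
  divide \<open>n\<close> by \<open>k\<close> with remainder.\<close>

lemma subadditive_eventually_le:
  fixes u :: "nat \<Rightarrow> real"
  assumes sub: "\<And>m n. u (m + n) \<le> u m + u n" and nn: "\<And>n. 0 \<le> u n" and "0 < \<epsilon>"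
  shows "\<exists>N. \<forall>n\<ge>N. u n \<le> real n * ((INF n\<in>{1..}. u n / real n) + \<epsilon>)"
proof -
  define l where "l = (INF n\<in>{1..}. u n / real n)"
  have l0: "0 \<le> l"
    unfolding l_def by (rule cINF_greatest) (use nn in auto)
  have bdd: "bdd_below ((\<lambda>n. u n / real n) ` {1..})"
    by (rule bdd_belowI[of _ 0]) (use nn in auto)
  have "\<exists>k\<in>{1..}. u k / real k < l + \<epsilon> / 2"
  proof -
    have "(INF n\<in>{1..}. u n / real n) < l + \<epsilon> / 2"
      using \<open>0 < \<epsilon>\<close> by (simp add: l_def)
    then show ?thesis
      using cINF_less_iff[OF _ bdd, of "l + \<epsilon> / 2"] by auto
  qed
  then obtain k where k: "k \<ge> 1" "u k \<le> real k * (l + \<epsilon> / 2)"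
    by (force simp: field_simps)
  \<comment> \<open>Bounds the contribution of any remainder; it is at most
    \<open>n * \<epsilon> / 2\<close> once \<open>n\<close> exceeds
    \<open>2 * c / \<epsilon>\<close>.\<close>
  define c where "c = Max (u ` {..<k})"
  have c: "u j \<le> c" if "j < k" for j
    unfolding c_def using that by (intro Max_ge) auto
  have "u n \<le> real n * (l + \<epsilon>)" if n: "n \<ge> nat \<lceil>2 * c / \<epsilon>\<rceil>" for n
  proof -
    have "2 * c / \<epsilon> \<le> real n"
      using n by linarith
    then have cn: "c \<le> real n * (\<epsilon> / 2)"
      using \<open>0 < \<epsilon>\<close> by (simp add: field_simps)
    have "u n = u (n div k * k + n mod k)" by simp
    also have "\<dots> \<le> real (n div k) * u k + u (n mod k)"
      by (rule subadditive_mult_add) (rule sub)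
    also have "\<dots> \<le> real (n div k) * (real k * (l + \<epsilon> / 2)) + c"
      using k by (intro add_mono mult_left_mono c) auto
    also have "real (n div k) * (real k * (l + \<epsilon> / 2)) = real (n div k * k) * (l + \<epsilon> / 2)"
      by simp
    also have "\<dots> \<le> real n * (l + \<epsilon> / 2)"
      using l0 \<open>0 < \<epsilon>\<close> by (intro mult_right_mono) (auto simp del: of_nat_mult)
    finally show ?thesis
      using cn by (simp add: algebra_simps)
  qed
  then show ?thesis unfolding l_def by blast
qed

lemma subadditive_ge:
  fixes u :: "nat \<Rightarrow> real"
  assumes nn: "\<And>n. 0 \<le> u n"
  shows "real n * (INF n\<in>{1..}. u n / real n) \<le> u n"
proof (cases "n = 0")
  case False
  have "(INF n\<in>{1..}. u n / real n) \<le> u n / real n"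
    by (rule cINF_lower) (use False nn in \<open>auto intro!: bdd_belowI[of _ 0]\<close>)
  then show ?thesis using False by (simp add: field_simps)
qed (use nn in simp)

text \<open>The windowed average \<open>s\<close> below has increments equal to the left hand side, and grows
  at least like \<open>2 n (l - \<epsilon>)\<close>.\<close>

lemma common_large_increment:
  fixes u :: "nat \<Rightarrow> real"
  assumes lower: "\<And>n. n \<ge> N1 \<Longrightarrow> real n * (l - \<epsilon>) \<le> u n" and \<epsilon>: "0 < \<epsilon>" "\<epsilon> \<le> l"
    and m: "1 \<le> m" "1 \<le> m'"
  shows "\<exists>n\<ge>L. 2 * l - 4 * \<epsilon> \<le> (u n - u (n - m)) / real m + (u n - u (n - m')) / real m'"
proof (rule ccontr)
  assume "\<not> ?thesis"
  then have small: "(u n - u (n - m)) / real m + (u n - u (n - m')) / real m' < 2 * l - 4 * \<epsilon>" if "n \<ge> L" for n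
    using that by (meson not_le)
  define s where "s n = (\<Sum>i<m. u (n - i)) / real m + (\<Sum>i<m'. u (n - i)) / real m'" for n
  define L0 where "L0 = L + m + m'"
  \<comment> \<open>Moving a window by one adds one value at the front and drops one at the back;
    truncated subtraction does no harm, since \<open>Suc n - Suc i = n - i\<close>.\<close>
  have win: "(\<Sum>i<k. u (Suc n - i)) - (\<Sum>i<k. u (n - i)) = u (Suc n) - u (Suc n - k)" if k: "k \<ge> 1" for n k
  proof -
    obtain k' where k': "k = Suc k'" using k by (cases k) auto
    have "(\<Sum>i<Suc k'. u (Suc n - i)) = u (Suc n) + (\<Sum>i<k'. u (n - i))"
      by (subst sum.lessThan_Suc_shift) simp
    then show ?thesis by (simp add: k')
  qed
  have step: "s (Suc n) - s n < 2 * l - 4 * \<epsilon>" if "n \<ge> L" for n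
  proof -
    have "s (Suc n) - s n = ((\<Sum>i<m. u (Suc n - i)) - (\<Sum>i<m. u (n - i))) / real m +
       ((\<Sum>i<m'. u (Suc n - i)) - (\<Sum>i<m'. u (n - i))) / real m'"
      by (simp add: s_def diff_divide_distrib)
    also have "\<dots> = (u (Suc n) - u (Suc n - m)) / real m + (u (Suc n) - u (Suc n - m')) / real m'"
      by (simp only: win[OF m(1)] win[OF m(2)])
    also have "\<dots> < 2 * l - 4 * \<epsilon>"
      using that by (intro small) simp
    finally show ?thesis .
  qed
  have up: "s (L0 + k) \<le> s L0 + real k * (2 * l - 4 * \<epsilon>)" for k
  proof (induction k)
    case (Suc k)
    then show ?case using step[of "L0 + k"] by (simp add: L0_def algebra_simps)
  qed simp
  have low: "2 * real k * (l - \<epsilon>) \<le> s (L0 + k)" if "k \<ge> N1" for k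
  proof -
    have "real k * (l - \<epsilon>) \<le> (\<Sum>i<j. u (L0 + k - i)) / real j" if "j = m \<or> j = m'" for j
    proof -
      have j: "1 \<le> j" "j \<le> L0" using that m by (auto simp: L0_def)
      have "(\<Sum>i<j. real k * (l - \<epsilon>)) \<le> (\<Sum>i<j. u (L0 + k - i))"
      proof (rule sum_mono)
        fix i assume "i \<in> {..<j}"
        then have i: "L0 + k - i \<ge> k" using j by auto
        have "real k * (l - \<epsilon>) \<le> real (L0 + k - i) * (l - \<epsilon>)"
          using i \<epsilon> by (intro mult_right_mono) auto
        also have "\<dots> \<le> u (L0 + k - i)"
          using i \<open>k \<ge> N1\<close> by (intro lower) simp
        finally show "real k * (l - \<epsilon>) \<le> u (L0 + k - i)" .
      qed
      then show ?thesis using j by (simp add: field_simps)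
    qed
    from this[of m] this[of m'] show ?thesis by (simp add: s_def)
  qed
  \<comment> \<open>After \<open>k\<close> steps the two bounds on \<open>s\<close> are
    \<open>2 * \<epsilon> * k\<close> apart, and this \<open>k\<close> makes that gap larger than
    the initial value \<open>s L0\<close>.\<close>
  define k where "k = max N1 (nat \<lceil>s L0 / \<epsilon>\<rceil> + 1)"
  have "2 * real k * (l - \<epsilon>) \<le> s L0 + real k * (2 * l - 4 * \<epsilon>)"
    using up[of k] low[of k] by (simp add: k_def)
  then have "2 * \<epsilon> * real k \<le> s L0" by (simp add: algebra_simps)
  moreover have "s L0 / \<epsilon> < real k" unfolding k_def by linarith
  then have "s L0 < \<epsilon> * real k" using \<epsilon> by (simp add: field_simps)
  moreover have "\<epsilon> * real k \<ge> 0" using \<epsilon> by simp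
  ultimately show False by linarith
qed

section \<open>Escape rate\<close>

locale ergodic_walk = isometric_walk P X b a B
  for P :: "'e::countable \<Rightarrow> 'e pmf" and X :: "'e \<Rightarrow> ('h::metric_space \<Rightarrow> 'h)" and b a B +
  fixes \<pi> :: "'e pmf" and C \<rho> \<delta> :: real
  assumes stationary: "bind_pmf \<pi> P = \<pi>"
    and C_pos: "0 < C" and rho: "0 < \<rho>" "\<rho> < 1"
    and mixing: "tv_dist (kernel_pow P n z) \<pi> \<le> C * \<rho> ^ n"
    and irreducible: "irreducible_kernel P"
    and hyperbolic: "gromov_hyperbolic \<delta> TYPE('h)"
begin

lemma mixing_eventually: "0 < \<epsilon> \<Longrightarrow> \<exists>k. \<forall>z. tv_dist (kernel_pow P k z) \<pi> \<le> \<epsilon>"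
proof -
  assume "0 < \<epsilon>"
  then obtain k where "\<rho> ^ k < \<epsilon> / C"
    using real_arch_pow_inv[of "\<epsilon> / C" \<rho>] rho C_pos by auto
  then have "C * \<rho> ^ k \<le> \<epsilon>"
    using C_pos by (simp add: field_simps)
  then show ?thesis using mixing order_trans by blast
qed

definition ekap :: "nat \<Rightarrow> 'e \<Rightarrow> real" where
  "ekap n x = measure_pmf.expectation (path_pmf P n x) kap"

lemma ekap_nonneg [simp]: "0 \<le> ekap n x"
  by (simp add: ekap_def)

lemma nn_integral_kap: "(\<integral>\<^sup>+zs. ennreal (kap zs) \<partial>path_pmf P n x) = ennreal (ekap n x)"
  unfolding ekap_def by (intro nn_integral_eq_integral integrable_kap) simp

text \<open>The mean from one state is not subadditive, because the walk restarts elsewhere; the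
  supremum over all states is.\<close>

definition akap :: "nat \<Rightarrow> real" where
  "akap n = (SUP x. ekap n x)"

lemma ekap_bound: "ekap n x \<le> B ^ n / a"
proof -
  have "ekap n x \<le> measure_pmf.expectation (path_pmf P n x) (\<lambda>zs. exp (a * kap zs) / a)"
    unfolding ekap_def by (intro integral_mono integrable_kap integrable_divide integrable_exp_kap kap_le_exp)
  also have "\<dots> \<le> B ^ n / a"
    using expectation_exp_kap[of n x] a_pos by (simp add: divide_right_mono)
  finally show ?thesis .
qed

lemma ekap_le_akap: "ekap n x \<le> akap n"
  unfolding akap_def by (rule cSUP_upper) (auto intro!: bdd_aboveI[of _ "B ^ n / a"] ekap_bound)

lemma akap_nonneg: "0 \<le> akap n"
  using ekap_le_akap[of n undefined] ekap_nonneg[of n undefined] by linarith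

lemma ekap_append_le:
  "ennreal (ekap (m + n) x) \<le> ennreal (ekap m x) + (\<integral>\<^sup>+z. ennreal (ekap n z) \<partial>kernel_pow P m x)"
proof -
  have "ennreal (ekap (m + n) x) =
      (\<integral>\<^sup>+us. (\<integral>\<^sup>+vs. ennreal (kap (us @ vs)) \<partial>path_pmf P n (last (x # us))) \<partial>path_pmf P m x)"
    unfolding nn_integral_kap[symmetric] by (rule nn_integral_path_append)
  also have "\<dots> \<le> (\<integral>\<^sup>+us. (\<integral>\<^sup>+vs. ennreal (kap us) + ennreal (kap vs) \<partial>path_pmf P n (last (x # us))) \<partial>path_pmf P m x)"
    by (intro nn_integral_mono) (simp add: kap_append ennreal_leI flip: ennreal_plus)
  also have "\<dots> = (\<integral>\<^sup>+us. ennreal (kap us) + ennreal (ekap n (last (x # us))) \<partial>path_pmf P m x)"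
    by (simp add: nn_integral_add nn_integral_kap del: last.simps)
  also have "\<dots> = ennreal (ekap m x) + (\<integral>\<^sup>+us. ennreal (ekap n (last (x # us))) \<partial>path_pmf P m x)"
    by (simp add: nn_integral_add nn_integral_kap del: last.simps)
  finally show ?thesis
    by (simp only: nn_integral_last_path[where f="\<lambda>z. ennreal (ekap n z)"])
qed

lemma ekap_append_ge:
  "(\<integral>\<^sup>+z. ennreal (ekap n z) \<partial>kernel_pow P m x) \<le> ennreal (ekap m x) + ennreal (ekap (m + n) x)"
proof -
  have "(\<integral>\<^sup>+z. ennreal (ekap n z) \<partial>kernel_pow P m x) =
     (\<integral>\<^sup>+us. (\<integral>\<^sup>+vs. ennreal (kap vs) \<partial>path_pmf P n (last (x # us))) \<partial>path_pmf P m x)"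
    by (simp only: nn_integral_kap nn_integral_last_path[where f="\<lambda>z. ennreal (ekap n z)", symmetric])
  also have "\<dots> \<le> (\<integral>\<^sup>+us. (\<integral>\<^sup>+vs. ennreal (kap us) + ennreal (kap (us @ vs)) \<partial>path_pmf P n (last (x # us))) \<partial>path_pmf P m x)"
    by (intro nn_integral_mono) (simp add: kap_suffix_le ennreal_leI flip: ennreal_plus)
  also have "\<dots> = (\<integral>\<^sup>+us. ennreal (kap us) + (\<integral>\<^sup>+vs. ennreal (kap (us @ vs)) \<partial>path_pmf P n (last (x # us))) \<partial>path_pmf P m x)"
    by (simp add: nn_integral_add del: last.simps)
  also have "\<dots> = ennreal (ekap m x) + (\<integral>\<^sup>+us. (\<integral>\<^sup>+vs. ennreal (kap (us @ vs)) \<partial>path_pmf P n (last (x # us))) \<partial>path_pmf P m x)"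
    by (simp add: nn_integral_add nn_integral_kap del: last.simps)
  also have "\<dots> = ennreal (ekap m x) + ennreal (ekap (m + n) x)"
    by (simp only: nn_integral_path_append[where f="\<lambda>zs. ennreal (kap zs)", symmetric] nn_integral_kap)
  finally show ?thesis .
qed

lemma akap_subadditive: "akap (m + n) \<le> akap m + akap n"
proof -
  have "ekap (m + n) x \<le> akap m + akap n" for x
  proof -
    have "ennreal (ekap (m + n) x) \<le> ennreal (ekap m x) + (\<integral>\<^sup>+z. ennreal (ekap n z) \<partial>kernel_pow P m x)"
      by (rule ekap_append_le)
    also have "\<dots> \<le> ennreal (akap m) + ennreal (akap n)"
      by (intro add_mono nn_integral_pmf_le_const ennreal_leI ekap_le_akap)
    finally show ?thesis
      by (simp add: akap_nonneg flip: ennreal_plus)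
  qed
  then show ?thesis unfolding akap_def[of "m + n"] by (intro cSUP_least) auto
qed

text \<open>By Fekete's lemma this infimum is the limit of \<open>akap n / n\<close>, the escape
  rate.\<close>

definition speed :: real where
  "speed = (INF n\<in>{1..}. akap n / real n)"

lemma speed_nonneg: "0 \<le> speed"
  unfolding speed_def by (rule cINF_greatest) (use akap_nonneg in auto)

lemma ekap_upper:
  assumes "0 < \<epsilon>"
  shows "\<exists>N. \<forall>n\<ge>N. \<forall>x. ekap n x \<le> real n * (speed + \<epsilon>)"
  using subadditive_eventually_le[of akap, OF akap_subadditive akap_nonneg assms] ekap_le_akap order_trans
  unfolding speed_def by blast

text \<open>After \<open>k\<close> steps both starting states have laws close to
  \<open>\<pi>\<close>, so the remaining means differ by at most two total variation errors;
  discarding the first \<open>k\<close> steps costs at most \<open>akap k\<close> on each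
  side.\<close>

lemma ekap_mix:
  assumes "\<And>z. tv_dist (kernel_pow P k z) \<pi> \<le> \<tau>"
  shows "ekap (k + n) x' \<le> ekap (k + n) x + 2 * akap k + 2 * akap n * \<tau>"
proof -
  let ?f = "\<lambda>z. ennreal (ekap n z)"
  have tau: "0 \<le> \<tau>"
    using assms[of x] prob_diff_le_tv[of "kernel_pow P k x" "{}" \<pi>] by simp
  have f: "?f z \<le> ennreal (akap n)" for z
    by (intro ennreal_leI ekap_le_akap)
  have tv: "akap n * tv_dist (kernel_pow P k z) \<pi> \<le> akap n * \<tau>" for z
    by (intro mult_left_mono assms akap_nonneg)
  have "ennreal (ekap (k + n) x') \<le> ennreal (ekap k x') + (\<integral>\<^sup>+z. ?f z \<partial>kernel_pow P k x')"
    by (rule ekap_append_le)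
  also have "(\<integral>\<^sup>+z. ?f z \<partial>kernel_pow P k x') \<le> (\<integral>\<^sup>+z. ?f z \<partial>\<pi>) + ennreal (akap n * \<tau>)"
    by (rule order_trans[OF nn_integral_le_tv[OF f akap_nonneg, where \<nu>=\<pi>]]) (intro add_left_mono ennreal_leI tv)
  also have "(\<integral>\<^sup>+z. ?f z \<partial>\<pi>) \<le> (\<integral>\<^sup>+z. ?f z \<partial>kernel_pow P k x) + ennreal (akap n * \<tau>)"
    by (rule order_trans[OF nn_integral_le_tv[OF f akap_nonneg, where \<nu>="kernel_pow P k x"]])
      (intro add_left_mono ennreal_leI, subst tv_dist_commute, rule tv)
  also have "(\<integral>\<^sup>+z. ?f z \<partial>kernel_pow P k x) \<le> ennreal (ekap k x) + ennreal (ekap (k + n) x)"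
    by (rule ekap_append_ge)
  finally have "ennreal (ekap (k + n) x') \<le>
      ennreal (ekap k x' + (ekap k x + ekap (k + n) x + akap n * \<tau> + akap n * \<tau>))"
    by (simp add: akap_nonneg tau add_left_mono add_right_mono flip: ennreal_plus)
  then have "ekap (k + n) x' \<le> ekap k x' + (ekap k x + ekap (k + n) x + akap n * \<tau> + akap n * \<tau>)"
    by (subst (asm) ennreal_le_iff) (auto simp: akap_nonneg tau intro!: add_nonneg_nonneg)
  then show ?thesis
    using ekap_le_akap[of k x] ekap_le_akap[of k x'] by linarith
qed

text \<open>The supremum \<open>akap n\<close> is at least \<open>n * speed\<close>, and by mixing
  no starting state lags far behind it. This makes the lower bound uniform.\<close>

lemma ekap_lower:
  assumes "0 < \<epsilon>"
  shows "\<exists>N. \<forall>n\<ge>N. \<forall>x. real n * (speed - \<epsilon>) \<le> ekap n x"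
proof -
  \<comment> \<open>\<open>D\<close> bounds \<open>akap n / n\<close>, and the added 1 keeps it
    positive for the division in \<open>\<tau>\<close>. The mixing error and the discarded steps
    then each cost at most \<open>n * \<epsilon> / 2\<close>.\<close>
  define D where "D = akap 1 + 1"
  have D: "0 < D" "akap n \<le> real n * D" for n
  proof -
    show "0 < D" using akap_nonneg[of 1] by (simp add: D_def)
    have "akap 0 = 0"
      by (simp add: akap_def ekap_def kap_def)
    then have "akap n \<le> real n * akap 1"
      using subadditive_mult_add[of akap n 1 0, OF akap_subadditive] by simp
    then show "akap n \<le> real n * D" by (simp add: D_def algebra_simps)
  qed
  define \<tau> where "\<tau> = \<epsilon> / (4 * D)"
  have "0 < \<tau>" using assms D by (simp add: \<tau>_def)
  then obtain k where k: "\<And>z. tv_dist (kernel_pow P k z) \<pi> \<le> \<tau>"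
    using mixing_eventually[of \<tau>] by auto
  define N where "N = max k (nat \<lceil>4 * akap k / \<epsilon>\<rceil>)"
  have "real n * (speed - \<epsilon>) \<le> ekap n x" if "n \<ge> N" for n x
  proof -
    have nk: "n \<ge> k" and "4 * akap k / \<epsilon> \<le> real n"
      using that by (auto simp: N_def)
    then have n4: "4 * akap k \<le> real n * \<epsilon>"
      using assms by (simp add: field_simps)
    have "ekap n x' \<le> ekap n x + real n * \<epsilon>" for x'
    proof -
      have "ekap (k + (n - k)) x' \<le> ekap (k + (n - k)) x + 2 * akap k + 2 * akap (n - k) * \<tau>"
        by (rule ekap_mix) (rule k)
      moreover have "akap (n - k) * \<tau> \<le> (real n * D) * \<tau>"
        using \<open>0 < \<tau>\<close> D(1) by (intro mult_right_mono order_trans[OF D(2)]) auto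
      moreover have "real n * D * \<tau> = real n * \<epsilon> / 4"
        using D(1) by (simp add: \<tau>_def)
      ultimately show ?thesis using n4 nk by simp
    qed
    then have "akap n \<le> ekap n x + real n * \<epsilon>"
      unfolding akap_def by (intro cSUP_least) auto
    moreover have "real n * speed \<le> akap n"
      unfolding speed_def by (rule subadditive_ge) (rule akap_nonneg)
    ultimately show ?thesis by (simp add: algebra_simps)
  qed
  then show ?thesis by blast
qed

lemma expectation_disp_le: "\<bar>measure_pmf.expectation (path_pmf P n x) (disp w)\<bar> \<le> ekap n x"
proof -
  have "\<bar>measure_pmf.expectation (path_pmf P n x) (disp w)\<bar> \<le>
      measure_pmf.expectation (path_pmf P n x) (\<lambda>zs. \<bar>disp w zs\<bar>)"
    by (rule integral_abs_bound)
  also have "\<dots> \<le> ekap n x"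
    unfolding ekap_def by (intro integral_mono integrable_kap integrable_abs integrable_disp abs_disp_le)
  finally show ?thesis .
qed

text \<open>The part of \<open>kap\<close> above its typical size. A negligible mean of this part
  replaces uniform integrability when \<open>kap\<close> is estimated on events of small
  probability.\<close>

definition excess :: "real \<Rightarrow> nat \<Rightarrow> 'e list \<Rightarrow> real" where
  "excess \<epsilon> n zs = max 0 (kap zs - real n * (speed + \<epsilon>))"

text \<open>The excess is at most \<open>exp (s * (kap zs - n * (speed + \<epsilon>))) / s\<close>,
  whose mean stays bounded in \<open>n\<close> by the Chernoff estimate for \<open>disp b\<close>,
  that is, for \<open>kap\<close>.\<close>

lemma excess_small:
  assumes "0 < \<epsilon>"
  shows "\<exists>N. \<forall>n\<ge>N. \<forall>x. (\<integral>\<^sup>+zs. ennreal (excess \<epsilon> n zs) \<partial>path_pmf P n x) \<le> ennreal (\<epsilon> * real n)"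
proof -
  have "0 < \<epsilon> / 2" using assms by simp
  from ekap_upper[OF this] obtain N0 where N0: "\<And>n x. n \<ge> N0 \<Longrightarrow> ekap n x \<le> real n * (speed + \<epsilon> / 2)"
    by blast
  have drift: "1 * measure_pmf.expectation (path_pmf P (max 1 N0) x) (disp w) \<le> real (max 1 N0) * (speed + \<epsilon> / 2)" for x w
    using expectation_disp_le[of "max 1 N0" x w] N0[of "max 1 N0" x] by simp
  obtain s K where s: "0 < s" "0 < K" and
    le: "\<And>x w n. (\<integral>\<^sup>+zs. ennreal (exp (s * (1 * disp w zs))) \<partial>path_pmf P n x) \<le> ennreal (K * exp (s * real n * (speed + \<epsilon>)))"
    by (rule exp_moment_drift[OF _ _ _ drift, of "speed + \<epsilon>"]) (use assms in auto)
  have "(\<integral>\<^sup>+zs. ennreal (excess \<epsilon> n zs) \<partial>path_pmf P n x) \<le> ennreal (\<epsilon> * real n)"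
    if "n \<ge> nat \<lceil>K / (s * \<epsilon>)\<rceil>" for n x
  proof -
    define q where "q = exp (- (s * real n * (speed + \<epsilon>))) / s"
    have q: "0 \<le> q" using s by (simp add: q_def)
    have pt: "excess \<epsilon> n zs \<le> q * exp (s * (1 * disp b zs))" for zs
    proof -
      have "s * excess \<epsilon> n zs \<le> exp (s * (kap zs - real n * (speed + \<epsilon>)))"
      proof -
        have "s * (kap zs - real n * (speed + \<epsilon>)) \<le> exp (s * (kap zs - real n * (speed + \<epsilon>)))"
          using exp_ge_add_one_self[of "s * (kap zs - real n * (speed + \<epsilon>))"] by linarith
        then show ?thesis by (auto simp: excess_def max_def)
      qed
      also have "\<dots> = exp (- (s * real n * (speed + \<epsilon>))) * exp (s * kap zs)"
        by (simp add: algebra_simps flip: exp_add)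
      finally show ?thesis
        using s by (simp add: q_def disp_base field_simps)
    qed
    have "(\<integral>\<^sup>+zs. ennreal (excess \<epsilon> n zs) \<partial>path_pmf P n x) \<le>
      (\<integral>\<^sup>+zs. ennreal q * ennreal (exp (s * (1 * disp b zs))) \<partial>path_pmf P n x)"
      using q by (intro nn_integral_mono) (simp add: ennreal_leI pt[simplified] flip: ennreal_mult)
    also have "\<dots> = ennreal q * (\<integral>\<^sup>+zs. ennreal (exp (s * (1 * disp b zs))) \<partial>path_pmf P n x)"
      by (rule nn_integral_cmult) simp
    also have "\<dots> \<le> ennreal q * ennreal (K * exp (s * real n * (speed + \<epsilon>)))"
      by (intro mult_left_mono le) simp
    also have "\<dots> = ennreal (K / s)"
    proof -
      have "q * (K * exp (s * real n * (speed + \<epsilon>))) = K / s"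
        unfolding q_def by (simp add: exp_minus)
      then show ?thesis using q s by (simp flip: ennreal_mult)
    qed
    also have "\<dots> \<le> ennreal (\<epsilon> * real n)"
    proof (rule ennreal_leI)
      have "K / (s * \<epsilon>) \<le> real n" using that by linarith
      then show "K / s \<le> \<epsilon> * real n" using s assms by (simp add: field_simps)
    qed
    finally show ?thesis .
  qed
  then show ?thesis by blast
qed

section \<open>Convergence in probability of the inverse walk\<close>

definition path_pi :: "nat \<Rightarrow> 'e list pmf" where
  "path_pi n = bind_pmf \<pi> (path_pmf P n)"

lemma bind_kernel_pow: "bind_pmf \<pi> (kernel_pow P n) = \<pi>"
proof (induction n)
  case 0
  then show ?case by (simp add: bind_return_pmf')
next
  case (Suc n)
  have "bind_pmf \<pi> (kernel_pow P (Suc n)) = bind_pmf (bind_pmf \<pi> P) (kernel_pow P n)"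
    by (simp add: bind_assoc_pmf fun_eq_iff cong: bind_pmf_cong_simp)
  then show ?case by (simp only: stationary Suc)
qed

lemma take_path_pi: "m \<le> n \<Longrightarrow> map_pmf (take m) (path_pi n) = path_pi m"
  by (simp add: path_pi_def map_bind_pmf take_path_pmf')

text \<open>The point of starting from \<open>\<pi>\<close>: a suffix of a stationary path is again
  a stationary path, so its mean length depends on the number of steps only.\<close>

lemma drop_path_pi: 
  assumes "m \<le> n" shows "map_pmf (drop m) (path_pi n) = path_pi (n - m)"
proof -
  have *: "map_pmf (drop m) (path_pmf P (m + k) x) = bind_pmf (kernel_pow P m x) (path_pmf P k)" for k x
  proof -
    have "map_pmf (drop m) (path_pmf P (m + k) x) =
       bind_pmf (path_pmf P m x) (\<lambda>us. map_pmf (\<lambda>vs. drop m (us @ vs)) (path_pmf P k (last (x # us))))"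
      by (simp add: path_pmf_append map_bind_pmf map_pmf_comp)
    also have "\<dots> = bind_pmf (path_pmf P m x) (\<lambda>us. map_pmf (\<lambda>vs. vs) (path_pmf P k (last (x # us))))"
      by (intro bind_pmf_cong refl map_pmf_cong) (auto dest: length_path_pmf)
    also have "\<dots> = bind_pmf (map_pmf (\<lambda>us. last (x # us)) (path_pmf P m x)) (path_pmf P k)"
      by (simp add: bind_map_pmf)
    finally show ?thesis unfolding last_path_pmf .
  qed
  have "map_pmf (drop m) (path_pi (m + (n - m))) = bind_pmf (bind_pmf \<pi> (kernel_pow P m)) (path_pmf P (n - m))"
    unfolding path_pi_def map_bind_pmf * by (simp add: bind_assoc_pmf)
  then show ?thesis using assms by (simp add: bind_kernel_pow path_pi_def)
qed

lemma nn_integral_path_pi: "(\<integral>\<^sup>+zs. f zs \<partial>path_pi n) = (\<integral>\<^sup>+x. (\<integral>\<^sup>+zs. f zs \<partial>path_pmf P n x) \<partial>\<pi>)"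
  by (simp add: path_pi_def)

lemma integrable_kap_pi: "integrable (path_pi n) kap"
proof (rule integrableI_nonneg)
  have "(\<integral>\<^sup>+zs. ennreal (kap zs) \<partial>path_pi n) \<le> ennreal (B ^ n / a)"
    unfolding nn_integral_path_pi nn_integral_kap by (intro nn_integral_pmf_le_const ennreal_leI ekap_bound)
  also have "\<dots> < \<infinity>" by simp
  finally show "(\<integral>\<^sup>+zs. ennreal (kap zs) \<partial>path_pi n) < \<infinity>" .
qed auto

definition pkap :: "nat \<Rightarrow> real" where
  "pkap n = measure_pmf.expectation (path_pi n) kap"

lemma nn_integral_pkap: "ennreal (pkap n) = (\<integral>\<^sup>+x. ennreal (ekap n x) \<partial>\<pi>)"
proof -
  have "(\<integral>\<^sup>+zs. ennreal (kap zs) \<partial>path_pi n) = ennreal (pkap n)"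
    unfolding pkap_def by (intro nn_integral_eq_integral integrable_kap_pi) simp
  then show ?thesis by (simp add: nn_integral_path_pi nn_integral_kap)
qed

lemma pkap_upper:
  assumes "0 < \<epsilon>"
  shows "\<exists>N. \<forall>n\<ge>N. pkap n \<le> real n * (speed + \<epsilon>)"
proof -
  have "pkap n \<le> real n * (speed + \<epsilon>)" if "\<forall>x. ekap n x \<le> real n * (speed + \<epsilon>)" for n
  proof -
    have "ennreal (pkap n) \<le> ennreal (real n * (speed + \<epsilon>))"
      unfolding nn_integral_pkap using that by (intro nn_integral_pmf_le_const ennreal_leI) auto
    then show ?thesis using assms speed_nonneg by simp
  qed
  then show ?thesis using ekap_upper[OF assms] by blast
qed

lemma pkap_lower:
  assumes "0 < \<epsilon>"
  shows "\<exists>N. \<forall>n\<ge>N. real n * (speed - \<epsilon>) \<le> pkap n"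
proof -
  have "real n * (speed - \<epsilon>) \<le> pkap n" if "\<forall>x. real n * (speed - \<epsilon>) \<le> ekap n x" for n
  proof -
    have "(\<integral>\<^sup>+x. ennreal (real n * (speed - \<epsilon>)) \<partial>\<pi>) \<le> ennreal (pkap n)"
      unfolding nn_integral_pkap using that by (intro nn_integral_mono ennreal_leI) auto
    then have "ennreal (real n * (speed - \<epsilon>)) \<le> ennreal (pkap n)" by simp
    moreover have "0 \<le> pkap n" by (simp add: pkap_def)
    ultimately show ?thesis by (metis ennreal_le_iff)
  qed
  then show ?thesis using ekap_lower[OF assms] by blast
qed

lemma pkap_subadditive: 
  assumes "m \<le> n" shows "pkap n \<le> pkap m + pkap (n - m)"
proof -
  have t: "integrable (path_pi n) (\<lambda>zs. kap (take m zs))"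
    using integrable_kap_pi[of m] take_path_pi[OF assms] integrable_map_pmf_eq[of "take m" "path_pi n" kap] by simp
  have d: "integrable (path_pi n) (\<lambda>zs. kap (drop m zs))"
    using integrable_kap_pi[of "n - m"] drop_path_pi[OF assms] integrable_map_pmf_eq[of "drop m" "path_pi n" kap] by simp
  have kap_le: "kap zs \<le> kap (take m zs) + kap (drop m zs)" for zs
    using kap_append[of "take m zs" "drop m zs"] by simp
  have "pkap n \<le> measure_pmf.expectation (path_pi n) (\<lambda>zs. kap (take m zs) + kap (drop m zs))"
    unfolding pkap_def
    by (intro integral_mono integrable_kap_pi Bochner_Integration.integrable_add t d kap_le)
  also have "\<dots> = pkap m + pkap (n - m)"
    by (simp add: t d pkap_def flip: take_path_pi[OF assms] drop_path_pi[OF assms])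
  finally show ?thesis .
qed

text \<open>The product has mean at least \<open>m * (speed - 3 * \<epsilon>)\<close>, while it is
  bounded by \<open>kap\<close> of the prefix, hence by \<open>m * (speed + \<epsilon>)\<close> plus
  the excess. A variable whose mean almost reaches its upper bound is rarely below half of
  it.\<close>

lemma prob_gp_prefix_small:
  assumes l: "0 < speed" and \<epsilon>: "0 < \<epsilon>" and mn: "1 \<le> m" "m \<le> n"
    and pm: "real m * (speed - \<epsilon>) \<le> pkap m"
    and inc: "real m * (speed - 5 * \<epsilon>) \<le> pkap n - pkap (n - m)"
    and ex: "\<And>x. (\<integral>\<^sup>+zs. ennreal (excess \<epsilon> m zs) \<partial>path_pmf P m x) \<le> ennreal (\<epsilon> * real m)"
  shows "measure_pmf.prob (path_pi n) {zs. gp (Y (take m zs)) (Y zs) < real m * speed / 2} \<le> 10 * \<epsilon> / speed"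
proof -
  let ?E = "measure_pmf.expectation (path_pi n)"
  let ?A = "{zs. gp (Y (take m zs)) (Y zs) < real m * speed / 2}"
  define G where "G zs = gp (Y (take m zs)) (Y zs)" for zs
  have t: "integrable (path_pi n) (\<lambda>zs. kap (take m zs))" "?E (\<lambda>zs. kap (take m zs)) = pkap m"
    using integrable_kap_pi[of m] integrable_map_pmf_eq[of "take m" "path_pi n" kap]
    by (simp_all add: pkap_def flip: take_path_pi[OF mn(2)])
  have d: "integrable (path_pi n) (\<lambda>zs. kap (drop m zs))" "?E (\<lambda>zs. kap (drop m zs)) = pkap (n - m)"
    using integrable_kap_pi[of "n - m"] integrable_map_pmf_eq[of "drop m" "path_pi n" kap]
    by (simp_all add: pkap_def flip: drop_path_pi[OF mn(2)])
  have G: "G zs = (kap (take m zs) + kap zs - kap (drop m zs)) / 2" for zs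
    using gp_Y_append[of "take m zs" "drop m zs"] by (simp add: G_def)
  have intG: "integrable (path_pi n) G"
    unfolding G by (intro integrable_divide Bochner_Integration.integrable_diff Bochner_Integration.integrable_add t d integrable_kap_pi)
  have EG: "?E G = (pkap m + pkap n - pkap (n - m)) / 2"
    unfolding G by (simp add: t d integrable_kap_pi pkap_def[symmetric])
  have exi: "(\<integral>\<^sup>+zs. ennreal (excess \<epsilon> m zs) \<partial>path_pi m) \<le> ennreal (\<epsilon> * real m)"
    unfolding nn_integral_path_pi by (intro nn_integral_pmf_le_const ex)
  have int_ex: "integrable (path_pi m) (excess \<epsilon> m)"
    using exi by (intro integrableI_nonneg) (auto simp: excess_def less_top[symmetric] top_unique)
  have "measure_pmf.expectation (path_pi m) (excess \<epsilon> m) \<le> \<epsilon> * real m"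
    using exi \<epsilon> by (intro integral_real_bounded) auto
  then have e: "integrable (path_pi n) (\<lambda>zs. excess \<epsilon> m (take m zs))" "?E (\<lambda>zs. excess \<epsilon> m (take m zs)) \<le> \<epsilon> * real m"
    using int_ex integrable_map_pmf_eq[of "take m" "path_pi n" "excess \<epsilon> m"]
    by (simp_all flip: take_path_pi[OF mn(2)])
  have ind: "integrable (path_pi n) (\<lambda>zs. indicat_real ?A zs)"
    by (intro measure_pmf.integrable_const_bound[of _ 1]) (auto simp: indicator_def)
  \<comment> \<open>On the bad event \<open>G\<close> is below \<open>m * speed / 2\<close>, so
    subtracting that much from the upper bound still leaves a valid bound.\<close>
  have pt: "G zs \<le> real m * (speed + \<epsilon>) + excess \<epsilon> m (take m zs) - real m * speed / 2 * indicat_real ?A zs" for zs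
  proof (cases "zs \<in> ?A")
    case True
    have "real m * speed / 2 \<le> real m * (speed + \<epsilon>) - real m * speed / 2"
      using \<epsilon> by (simp add: algebra_simps)
    moreover have "0 \<le> excess \<epsilon> m (take m zs)" by (simp add: excess_def)
    ultimately show ?thesis using True by (simp add: G_def)
  next
    case False
    have "G zs \<le> kap (take m zs)"
      using gromov_product_le_dist1[of b "Y (take m zs)" "Y zs"] by (simp add: G_def dist_b_Y)
    then show ?thesis using False by (simp add: excess_def)
  qed
  have "?E G \<le> ?E (\<lambda>zs. real m * (speed + \<epsilon>) + excess \<epsilon> m (take m zs) - real m * speed / 2 * indicat_real ?A zs)"
    by (intro integral_mono intG pt Bochner_Integration.integrable_diff Bochner_Integration.integrable_add e integrable_mult_right ind measure_pmf.integrable_const)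
  also have "\<dots> = real m * (speed + \<epsilon>) + ?E (\<lambda>zs. excess \<epsilon> m (take m zs)) - real m * speed / 2 * measure_pmf.prob (path_pi n) ?A"
    using e ind by simp
  finally have "real m * speed / 2 * measure_pmf.prob (path_pi n) ?A \<le> real m * (speed + \<epsilon>) + \<epsilon> * real m - ?E G"
    using e by linarith
  also have "\<dots> \<le> real m * (5 * \<epsilon>)"
    unfolding EG using pm inc by (simp add: field_simps)
  finally have "real m * (speed / 2 * measure_pmf.prob (path_pi n) ?A) \<le> real m * (5 * \<epsilon>)"
    by (simp only: mult.assoc times_divide_eq_right times_divide_eq_left)
  then have "speed / 2 * measure_pmf.prob (path_pi n) ?A \<le> 5 * \<epsilon>"
    by (rule mult_left_le_imp_le) (use mn(1) in simp)
  then show ?thesis using l by (simp add: field_simps)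
qed

text \<open>\<open>Y\<close> at times \<open>m\<close> and \<open>m'\<close> is compared through
  \<open>Y\<close> at a later time \<open>n\<close> that suits both, at the cost of one
  \<open>\<delta>\<close>.\<close>

lemma inverse_walk_cauchy_pi:
  assumes l: "0 < speed" and \<eta>: "0 < \<eta>"
  shows "\<exists>m0. \<forall>m\<ge>m0. \<forall>m'\<ge>m0. \<forall>T. m \<le> T \<longrightarrow> m' \<le> T \<longrightarrow>
    measure_pmf.prob (path_pi T)
      {zs. gp (Y (take m zs)) (Y (take m' zs)) < real (min m m') * speed / 2 - \<delta>} \<le> \<eta>"
proof -
  \<comment> \<open>Each of the two comparisons fails with probability at most
    \<open>10 * \<epsilon> / speed\<close>, so each may use half of \<open>\<eta>\<close>;
    \<open>\<epsilon> \<le> speed\<close> is demanded by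
    \<open>common_large_increment\<close>.\<close>
  define \<epsilon> where "\<epsilon> = min speed (\<eta> * speed / 20)"
  have \<epsilon>: "0 < \<epsilon>" "\<epsilon> \<le> speed" "10 * \<epsilon> / speed \<le> \<eta> / 2"
    using l \<eta> by (auto simp: \<epsilon>_def min_def field_simps)
  obtain N1 where N1: "\<And>n. n \<ge> N1 \<Longrightarrow> real n * (speed - \<epsilon>) \<le> pkap n"
    using pkap_lower[OF \<epsilon>(1)] by blast
  obtain N2 where N2: "\<And>n. n \<ge> N2 \<Longrightarrow> pkap n \<le> real n * (speed + \<epsilon>)"
    using pkap_upper[OF \<epsilon>(1)] by blast
  obtain N3 where N3: "\<And>n x. n \<ge> N3 \<Longrightarrow> (\<integral>\<^sup>+zs. ennreal (excess \<epsilon> n zs) \<partial>path_pmf P n x) \<le> ennreal (\<epsilon> * real n)"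
    using excess_small[OF \<epsilon>(1)] by blast
  define m0 where "m0 = max 1 (max N1 (max N2 N3))"
  have "measure_pmf.prob (path_pi T)
      {zs. gp (Y (take m zs)) (Y (take m' zs)) < real (min m m') * speed / 2 - \<delta>} \<le> \<eta>"
    if m: "m \<ge> m0" "m' \<ge> m0" "m \<le> T" "m' \<le> T" for m m' T
  proof -
    have m1: "1 \<le> m" "1 \<le> m'" using m by (auto simp: m0_def)
    \<comment> \<open>The sum of the two normalised increments is at least
      \<open>2 * speed - 4 * \<epsilon>\<close> and each is at most
      \<open>speed + \<epsilon>\<close>, so each is at least \<open>speed - 5 * \<epsilon>\<close>.
      The event concerns the first \<open>T\<close> steps, so it may be viewed under the law of
      \<open>n\<close> steps.\<close>
    obtain n where n: "n \<ge> T" and inc: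
      "2 * speed - 4 * \<epsilon> \<le> (pkap n - pkap (n - m)) / real m + (pkap n - pkap (n - m')) / real m'"
      using common_large_increment[of N1 speed \<epsilon> pkap m m' T, OF N1 \<epsilon>(1,2) m1] by blast
    have up: "(pkap n - pkap (n - k)) / real k \<le> speed + \<epsilon>" if "k = m \<or> k = m'" for k
    proof -
      have "k \<le> n" "k \<ge> N2" "k \<ge> 1" using that m n m1 by (auto simp: m0_def)
      then have "pkap n - pkap (n - k) \<le> real k * (speed + \<epsilon>)"
        using pkap_subadditive[of k n] N2[of k] by linarith
      then show ?thesis using \<open>k \<ge> 1\<close> by (simp add: field_simps)
    qed
    have bad: "measure_pmf.prob (path_pi n) {zs. gp (Y (take k zs)) (Y zs) < real k * speed / 2} \<le> \<eta> / 2"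
      if k: "k = m \<or> k = m'" for k
    proof -
      have kk: "k \<le> n" "k \<ge> N1" "k \<ge> N3" "k \<ge> 1" using k m n m1 by (auto simp: m0_def)
      have "speed - 5 * \<epsilon> \<le> (pkap n - pkap (n - k)) / real k"
        using k inc up[of m] up[of m'] by auto
      then have "real k * (speed - 5 * \<epsilon>) \<le> pkap n - pkap (n - k)"
        using kk by (simp add: field_simps)
      then show ?thesis
        using prob_gp_prefix_small[OF l \<epsilon>(1) kk(4,1) N1[OF kk(2)] _ N3[OF kk(3)]] \<epsilon>(3) by linarith
    qed
    let ?A = "\<lambda>k. {zs. gp (Y (take k zs)) (Y zs) < real k * speed / 2}"
    let ?S = "{zs. gp (Y (take m zs)) (Y (take m' zs)) < real (min m m') * speed / 2 - \<delta>}"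
    have "measure_pmf.prob (path_pi T) ?S = measure_pmf.prob (path_pi n) (take T -` ?S)"
      by (simp flip: take_path_pi[OF n])
    also have "\<dots> \<le> measure_pmf.prob (path_pi n) (?A m \<union> ?A m')"
    proof (intro measure_pmf.finite_measure_mono subsetI)
      fix zs assume zs: "zs \<in> take T -` ?S"
      show "zs \<in> ?A m \<union> ?A m'"
      proof (rule ccontr)
        assume "zs \<notin> ?A m \<union> ?A m'"
        moreover have "real (min m m') * speed / 2 \<le> real m * speed / 2"
            "real (min m m') * speed / 2 \<le> real m' * speed / 2"
          using l by (auto intro!: divide_right_mono mult_right_mono)
        ultimately have "real (min m m') * speed / 2 \<le> gp (Y (take m zs)) (Y zs)"
          "real (min m m') * speed / 2 \<le> gp (Y zs) (Y (take m' zs))"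
          by (auto simp: gromov_product_commute[of b "Y zs"])
        then have "real (min m m') * speed / 2 - \<delta> \<le> gp (Y (take m zs)) (Y (take m' zs))"
          by (rule gromov_product_trans[OF hyperbolic])
        then show False using zs m by (simp add: min_absorb1)
      qed
    qed simp
    also have "\<dots> \<le> measure_pmf.prob (path_pi n) (?A m) + measure_pmf.prob (path_pi n) (?A m')"
      by (rule measure_Un_le) auto
    also have "\<dots> \<le> \<eta>" using bad[of m] bad[of m'] by simp
    finally show ?thesis .
  qed
  then show ?thesis by blast
qed

lemma pi_pos: "0 < pmf \<pi> x"
proof -
  obtain y where y: "y \<in> set_pmf \<pi>" using set_pmf_not_empty[of \<pi>] by blast
  obtain n where "0 < pmf (kernel_pow P n y) x"
    using irreducible unfolding irreducible_kernel_def by blast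
  then have "x \<in> set_pmf (bind_pmf \<pi> (kernel_pow P n))"
    using y by (auto intro!: bexI[of _ y] simp: set_pmf_iff[of x])
  then show ?thesis by (simp add: bind_kernel_pow pmf_positive)
qed

lemma prob_path_le_pi: "pmf \<pi> x * measure_pmf.prob (path_pmf P T x) S \<le> measure_pmf.prob (path_pi T) S"
proof -
  have "ennreal (pmf \<pi> x) * emeasure (path_pmf P T x) S =
      (\<integral>\<^sup>+y. emeasure (path_pmf P T x) S * indicator {x} y \<partial>\<pi>)"
    by (subst nn_integral_cmult_indicator) (auto simp: emeasure_pmf_single mult.commute)
  also have "\<dots> \<le> (\<integral>\<^sup>+y. emeasure (path_pmf P T y) S \<partial>\<pi>)"
    by (intro nn_integral_mono) (auto simp: indicator_def)
  also have "\<dots> = emeasure (path_pi T) S"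
    by (simp add: path_pi_def)
  finally show ?thesis
    by (simp add: measure_pmf.emeasure_eq_measure flip: ennreal_mult)
qed

text \<open>The stationary law contains the law from \<open>x\<close> with weight
  \<open>pmf \<pi> x\<close>, which is positive by irreducibility. The threshold \<open>m0\<close>
  therefore depends on \<open>x\<close>; uniformity in \<open>x\<close> is recovered by mixing in
  \<open>shadows_vanish\<close>.\<close>

lemma inverse_walk_cauchy:
  assumes l: "0 < speed" and \<eta>: "0 < \<eta>"
  shows "\<exists>m0. \<forall>m\<ge>m0. \<forall>m'\<ge>m0. \<forall>T. m \<le> T \<longrightarrow> m' \<le> T \<longrightarrow>
    measure_pmf.prob (path_pmf P T x)
      {zs. gp (Y (take m zs)) (Y (take m' zs)) < real (min m m') * speed / 2 - \<delta>} \<le> \<eta>"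
proof -
  have "0 < \<eta> * pmf \<pi> x" using \<eta> pi_pos by simp
  moreover have "measure_pmf.prob (path_pmf P T x) S \<le> \<eta>"
    if "measure_pmf.prob (path_pi T) S \<le> \<eta> * pmf \<pi> x" for T S
    using order_trans[OF prob_path_le_pi[of x T S] that] pi_pos[of x] by (simp add: mult.commute)
  ultimately show ?thesis
    using inverse_walk_cauchy_pi[OF l] by meson
qed

end

section \<open>Boundary points\<close>

lemma converges_at_infinity_isometry:
  assumes "isometry g" "converges_at_infinity b ws"
  shows "converges_at_infinity b (g \<circ> ws)"
  unfolding converges_at_infinity_def
proof
  fix K
  obtain N where N: "\<And>m n. m \<ge> N \<Longrightarrow> n \<ge> N \<Longrightarrow> K + dist (g b) b \<le> gromov_product b (ws m) (ws n)"
    using assms(2) unfolding converges_at_infinity_def by blast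
  have "K \<le> gromov_product b ((g \<circ> ws) m) ((g \<circ> ws) n)" if "m \<ge> N" "n \<ge> N" for m n
    using N[OF that] gromov_product_isometry_le[OF assms(1), of b "ws m" "ws n"] by simp
  then show "\<exists>N. \<forall>m\<ge>N. \<forall>n\<ge>N. K \<le> gromov_product b ((g \<circ> ws) m) ((g \<circ> ws) n)" by blast
qed

lemma infinity_equiv_isometry:
  assumes "isometry g" "infinity_equiv b ws ws'"
  shows "infinity_equiv b (g \<circ> ws) (g \<circ> ws')"
  unfolding infinity_equiv_def
proof
  fix K
  obtain N where N: "\<And>n. n \<ge> N \<Longrightarrow> K + dist (g b) b \<le> gromov_product b (ws n) (ws' n)"
    using assms(2) unfolding infinity_equiv_def by blast
  have "K \<le> gromov_product b ((g \<circ> ws) n) ((g \<circ> ws') n)" if "n \<ge> N" for n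
    using N[OF that] gromov_product_isometry_le[OF assms(1), of b "ws n" "ws' n"] by simp
  then show "\<exists>N. \<forall>n\<ge>N. K \<le> gromov_product b ((g \<circ> ws) n) ((g \<circ> ws') n)" by blast
qed

lemma infinity_equiv_sym: "infinity_equiv b ws ws' \<Longrightarrow> infinity_equiv b ws' ws"
  unfolding infinity_equiv_def by (simp add: gromov_product_commute)

lemma infinity_equiv_trans:
  fixes b :: "'h::metric_space"
  assumes hyp: "gromov_hyperbolic \<delta> TYPE('h)" and "infinity_equiv b u v" "infinity_equiv b v w"
  shows "infinity_equiv b u w"
  unfolding infinity_equiv_def
proof
  fix K
  obtain N where N: "\<And>n. n \<ge> N \<Longrightarrow> K + \<delta> \<le> gromov_product b (u n) (v n)"
    using assms(2) unfolding infinity_equiv_def by blast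
  obtain N' where N': "\<And>n. n \<ge> N' \<Longrightarrow> K + \<delta> \<le> gromov_product b (v n) (w n)"
    using assms(3) unfolding infinity_equiv_def by blast
  have "K \<le> gromov_product b (u n) (w n)" if "n \<ge> max N N'" for n
    using gromov_product_trans[OF hyp N[of n] N'[of n]] that by simp
  then show "\<exists>N. \<forall>n\<ge>N. K \<le> gromov_product b (u n) (w n)" by blast
qed

text \<open>Inequivalence bounds the product along infinitely many indices, and convergence of both
  sequences spreads the bound to all large ones with a loss of \<open>2 * \<delta>\<close>. The
  eventual form in \<open>R\<close> lets finitely many pairs share one bound.\<close>

lemma not_infinity_equiv_bounded:
  fixes b :: "'h::metric_space"
  assumes hyp: "gromov_hyperbolic \<delta> TYPE('h)"
    and u: "converges_at_infinity b u" and v: "converges_at_infinity b v" and "\<not> infinity_equiv b u v"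
  shows "\<forall>\<^sub>F R in at_top. \<forall>\<^sub>F n in sequentially. gromov_product b (u n) (v n) < R"
proof -
  obtain K where K: "\<And>N. \<exists>n\<ge>N. gromov_product b (u n) (v n) < K"
    using assms(4) unfolding infinity_equiv_def by (meson not_le)
  obtain N where N: "\<And>m n. m \<ge> N \<Longrightarrow> n \<ge> N \<Longrightarrow> K + 2 * \<delta> \<le> gromov_product b (u m) (u n)"
    using u unfolding converges_at_infinity_def by blast
  obtain N' where N': "\<And>m n. m \<ge> N' \<Longrightarrow> n \<ge> N' \<Longrightarrow> K + \<delta> \<le> gromov_product b (v m) (v n)"
    using v unfolding converges_at_infinity_def by blast
  obtain m where m: "m \<ge> max N N'" "gromov_product b (u m) (v m) < K"
    using K by blast
  have "gromov_product b (u n) (v n) < K + 2 * \<delta>" if "n \<ge> max N N'" for n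
  proof (rule ccontr)
    assume "\<not> ?thesis"
    then have "K + 2 * \<delta> - \<delta> \<le> gromov_product b (u m) (v n)"
      using m that by (intro gromov_product_trans[OF hyp N[of m n]]) auto
    then have "K + \<delta> - \<delta> \<le> gromov_product b (u m) (v m)"
      using m that by (intro gromov_product_trans[OF hyp _ N'[of n m]]) auto
    then show False using m by simp
  qed
  then have "\<forall>\<^sub>F n in sequentially. gromov_product b (u n) (v n) < K + 2 * \<delta>"
    by (rule eventually_sequentiallyI)
  then show ?thesis
    by (intro eventually_mono[OF eventually_ge_at_top[of "K + 2 * \<delta>"]])
      (auto elim!: eventually_mono)
qed

definition boundary_class :: "'h::metric_space \<Rightarrow> (nat \<Rightarrow> 'h) \<Rightarrow> (nat \<Rightarrow> 'h) set" where
  "boundary_class b ws = {ys. converges_at_infinity b ys \<and> infinity_equiv b ws ys}"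

lemma boundary_class_in_boundary:
  "converges_at_infinity b ws \<Longrightarrow> boundary_class b ws \<in> gromov_boundary b"
  unfolding gromov_boundary_def boundary_class_def by blast

lemma boundary_class_eqI:
  fixes b :: "'h::metric_space"
  assumes "gromov_hyperbolic \<delta> TYPE('h)" "infinity_equiv b u v"
  shows "boundary_class b u = boundary_class b v"
  using infinity_equiv_trans[OF assms(1) assms(2)]
    infinity_equiv_trans[OF assms(1) infinity_equiv_sym[OF assms(2)]]
  by (auto simp: boundary_class_def)

lemma isometry_inv:
  assumes "isometry g" shows "isometry (inv g)"
proof -
  have "dist (inv g x) (inv g y) = dist x y" for x y
    using isometry_dist_inv[OF assms, of "inv g x" y] assms
    by (simp add: isometry_def bij_is_surj surj_f_inv_f)
  then show ?thesis using assms by (simp add: isometry_def bij_imp_bij_inv)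
qed

text \<open>The image of a class is a full class because the inverse isometry brings every
  equivalent sequence back.\<close>

lemma boundary_act_class:
  fixes b :: "'h::metric_space"
  assumes g: "isometry g"
  shows "boundary_act g (boundary_class b ws) = boundary_class b (g \<circ> ws)"
proof
  show "boundary_act g (boundary_class b ws) \<subseteq> boundary_class b (g \<circ> ws)"
    using converges_at_infinity_isometry[OF g] infinity_equiv_isometry[OF g]
    by (auto simp: boundary_act_def boundary_class_def)
  have inv1: "g \<circ> (inv g \<circ> ys) = ys" for ys :: "nat \<Rightarrow> 'h"
    using g by (simp add: isometry_def fun_eq_iff bij_is_surj surj_f_inv_f)
  have inv2: "inv g \<circ> (g \<circ> ys) = ys" for ys :: "nat \<Rightarrow> 'h"
    using g by (simp add: isometry_def fun_eq_iff bij_is_inj)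
  show "boundary_class b (g \<circ> ws) \<subseteq> boundary_act g (boundary_class b ws)"
  proof
    fix ys assume ys: "ys \<in> boundary_class b (g \<circ> ws)"
    then have "converges_at_infinity b (inv g \<circ> ys)" "infinity_equiv b ws (inv g \<circ> ys)"
      using converges_at_infinity_isometry[OF isometry_inv[OF g]]
        infinity_equiv_isometry[OF isometry_inv[OF g], of b "g \<circ> ws" ys]
      by (auto simp: boundary_class_def inv2)
    then show "ys \<in> boundary_act g (boundary_class b ws)"
      unfolding boundary_act_def boundary_class_def
      by (intro image_eqI[of _ _ "inv g \<circ> ys"]) (auto simp: inv1)
  qed
qed

lemma inj_boundary_act: "isometry g \<Longrightarrow> inj (boundary_act g)"
  unfolding boundary_act_def
  by (intro inj_on_image inj_on_subset[OF fun.inj_map]) (auto simp: isometry_def bij_is_inj)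

lemma boundary_act_comp: "boundary_act (g \<circ> h) c = boundary_act g (boundary_act h c)"
  by (auto simp: boundary_act_def image_image comp_assoc)

text \<open>Equality case of a maximum principle: \<open>m - f\<close> is nonnegative with integral
  zero, hence zero at every state of positive mass. Finiteness of \<open>m\<close> makes the
  subtraction legitimate.\<close>

lemma nn_integral_pmf_eq_bound:
  fixes f :: "'e \<Rightarrow> ennreal"
  assumes le: "\<And>x. f x \<le> m" and "m \<noteq> \<infinity>" and ge: "m \<le> (\<integral>\<^sup>+x. f x \<partial>measure_pmf p)" and "x \<in> set_pmf p"
  shows "f x = m"
proof -
  have fin: "(\<integral>\<^sup>+x. f x \<partial>measure_pmf p) \<le> m"
    using nn_integral_mono[of p f "\<lambda>_. m"] le by simp
  have "(\<integral>\<^sup>+x. m - f x \<partial>measure_pmf p) = (\<integral>\<^sup>+x. m \<partial>measure_pmf p) - (\<integral>\<^sup>+x. f x \<partial>measure_pmf p)"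
    using fin assms(2) by (intro nn_integral_diff) (auto simp: le top_unique)
  also have "\<dots> = 0"
    using ge assms(2) by (simp add: diff_eq_0_iff_ennreal le_less_trans less_top[symmetric])
  finally have "AE x in measure_pmf p. m - f x = 0"
    by (subst (asm) nn_integral_0_iff_AE) auto
  then have "m - f x = 0" using assms(4) by (simp add: AE_measure_pmf_iff)
  then have "m \<le> f x"
    using assms(2) by (auto simp: diff_eq_0_iff_ennreal)
  then show ?thesis using le[of x] by simp
qed

lemma finite_by_card_bound:
  assumes "0 < c" "\<And>F. finite F \<Longrightarrow> F \<subseteq> T \<Longrightarrow> real (card F) * c \<le> 1"
  shows "finite T"
proof (rule ccontr)
  assume "\<not> finite T"
  then obtain F where F: "finite F" "card F = nat \<lceil>1 / c\<rceil> + 1" "F \<subseteq> T"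
    using infinite_arbitrarily_large by blast
  then have "real (nat \<lceil>1 / c\<rceil> + 1) * c \<le> 1" using assms(2)[OF F(1,3)] by simp
  moreover have "1 / c < real (nat \<lceil>1 / c\<rceil> + 1)" by linarith
  ultimately show False using assms(1) by (simp add: field_simps)
qed

text \<open>Adding one set to the union loses at most \<open>card F * \<eta>\<close>; the square is
  a convenient overestimate of the number of pairs.\<close>

lemma bonferroni_lower_bound:
  assumes "finite F" "0 \<le> \<eta>" "\<And>i. i \<in> F \<Longrightarrow> c \<le> measure_pmf.prob p (A i)"
    and "\<And>i j. i \<in> F \<Longrightarrow> j \<in> F \<Longrightarrow> i \<noteq> j \<Longrightarrow> measure_pmf.prob p (A i \<inter> A j) \<le> \<eta>"
  shows "real (card F) * c - (real (card F))\<^sup>2 * \<eta> \<le> measure_pmf.prob p (\<Union>i\<in>F. A i)"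
  using assms(1,3,4)
proof (induction F rule: finite_induct)
  case empty
  then show ?case by simp
next
  case (insert i F)
  let ?U = "\<Union>j\<in>F. A j"
  have IH: "real (card F) * c - (real (card F))\<^sup>2 * \<eta> \<le> measure_pmf.prob p ?U"
    by (rule insert.IH) (use insert.prems in auto)
  have "measure_pmf.prob p (A i \<inter> ?U) \<le> (\<Sum>j\<in>F. measure_pmf.prob p (A i \<inter> A j))"
    unfolding Int_UN_distrib
    by (rule measure_pmf.finite_measure_subadditive_finite) (use insert.hyps in auto)
  also have "\<dots> \<le> real (card F) * \<eta>"
    using insert.hyps(2) by (intro sum_bounded_above insert.prems(2)) auto
  finally have int: "measure_pmf.prob p (A i \<inter> ?U) \<le> real (card F) * \<eta>" .
  have "measure_pmf.prob p (A i \<union> ?U) = measure_pmf.prob p (A i) + measure_pmf.prob p ?U - measure_pmf.prob p (A i \<inter> ?U)"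
    by (rule measure_Un3) (simp_all only: measure_pmf.fmeasurable_eq_sets sets_measure_pmf UNIV_I)
  then have "real (card F) * c + c - (real (card F))\<^sup>2 * \<eta> - real (card F) * \<eta> \<le> measure_pmf.prob p (A i \<union> ?U)"
    using IH int insert.prems(1)[OF insertI1] by linarith
  moreover have "(real (card F) + 1)\<^sup>2 * \<eta> \<ge> (real (card F))\<^sup>2 * \<eta> + real (card F) * \<eta>"
    using assms(2) by (simp add: power2_eq_square algebra_simps)
  moreover have "real (card (insert i F)) = real (card F) + 1"
    using insert.hyps by simp
  moreover have "(real (card F) + 1) * c = real (card F) * c + c"
    by (simp add: algebra_simps)
  ultimately show ?case
    unfolding UN_insert by (simp only:)
qed

section \<open>Atoms of the hitting measures\<close>

locale transient_walk = ergodic_walk P X b a B \<pi> C \<rho> \<delta>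
  for P :: "'e::countable \<Rightarrow> 'e pmf" and X :: "'e \<Rightarrow> ('h::metric_space \<Rightarrow> 'h)" and b a B \<pi> C \<rho> \<delta> +
  assumes speed_pos: "0 < speed"
begin

abbreviation conv :: "(nat \<Rightarrow> 'h) \<Rightarrow> bool" where
  "conv \<equiv> converges_at_infinity b"

text \<open>The probability that the inverse walk at time \<open>n\<close> lies in the shadow of
  depth \<open>R\<close> around the direction of \<open>w\<close>, valued in \<open>ennreal\<close>
  so that limits and suprema combine directly with integrals.\<close>

definition shadow :: "'e \<Rightarrow> 'h \<Rightarrow> real \<Rightarrow> nat \<Rightarrow> ennreal" where
  "shadow x w R n = emeasure (path_pmf P n x) {zs. R \<le> gp w (Y zs)}"

text \<open>The probability that the inverse walk \<open>Y\<close> converges to the boundary point represented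
  by \<open>ws\<close>, expressed through the laws of finite paths only.\<close>

definition atom :: "'e \<Rightarrow> (nat \<Rightarrow> 'h) \<Rightarrow> ennreal" where
  "atom x ws = (INF R::nat. limsup (\<lambda>n. shadow x (ws n) (real R) n))"

lemma delta_nonneg: "0 \<le> \<delta>"
  using hyperbolic by (simp add: gromov_hyperbolic_def)

lemma shadow_le_1: "shadow x w R n \<le> 1"
  unfolding shadow_def by (rule measure_pmf.subprob_emeasure_le_1)

lemma shadow_antimono: "R \<le> R' \<Longrightarrow> shadow x w R' n \<le> shadow x w R n"
  unfolding shadow_def by (intro emeasure_mono) auto

lemma shadow_change_point:
  assumes "R + \<delta> \<le> gp w w'"
  shows "shadow x w (R + \<delta>) n \<le> shadow x w' R n"
  unfolding shadow_def
proof (intro emeasure_mono subsetI)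
  fix zs assume "zs \<in> {zs. R + \<delta> \<le> gp w (Y zs)}"
  then show "zs \<in> {zs. R \<le> gp w' (Y zs)}"
    using gromov_product_trans[OF hyperbolic, of "R + \<delta>" b w' w "Y zs"] assms
    by (simp add: gromov_product_commute)
qed simp

lemma shadow_take: "n \<le> T \<Longrightarrow> shadow x w R n = emeasure (path_pmf P T x) {zs. R \<le> gp w (Y (take n zs))}"
  unfolding shadow_def by (simp flip: take_path_pmf'[of n T] add: vimage_def)

text \<open>Outside an event of probability \<open>\<eta>\<close> the inverse walks at times
  \<open>n\<close> and \<open>m\<close> agree to depth \<open>R + \<delta>\<close>. This event does
  not involve \<open>w\<close>, so one \<open>N\<close> serves all points.\<close>

lemma shadow_change_time:
  assumes "0 < \<eta>"
  shows "\<exists>N. \<forall>n\<ge>N. \<forall>m\<ge>N. \<forall>w. shadow x w (R + \<delta>) n \<le> shadow x w R m + ennreal \<eta>"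
proof -
  obtain m0 where m0: "\<And>m m' T. m \<ge> m0 \<Longrightarrow> m' \<ge> m0 \<Longrightarrow> m \<le> T \<Longrightarrow> m' \<le> T \<Longrightarrow>
    measure_pmf.prob (path_pmf P T x)
      {zs. gp (Y (take m zs)) (Y (take m' zs)) < real (min m m') * speed / 2 - \<delta>} \<le> \<eta>"
    using inverse_walk_cauchy[OF speed_pos assms] by blast
  define N where "N = max m0 (nat \<lceil>2 * (R + 2 * \<delta>) / speed\<rceil>)"
  have "shadow x w (R + \<delta>) n \<le> shadow x w R m + ennreal \<eta>" if n: "n \<ge> N" "m \<ge> N" for n m w
  proof -
    define T where "T = max n m"
    have T: "n \<le> T" "m \<le> T" by (auto simp: T_def)
    let ?B = "{zs. gp (Y (take n zs)) (Y (take m zs)) < real (min n m) * speed / 2 - \<delta>}"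
    have "2 * (R + 2 * \<delta>) / speed \<le> real (min n m)"
      using n by (auto simp: N_def min_def)
    then have R: "R + \<delta> \<le> real (min n m) * speed / 2 - \<delta>"
      using speed_pos by (simp add: field_simps)
    have "shadow x w (R + \<delta>) n = emeasure (path_pmf P T x) {zs. R + \<delta> \<le> gp w (Y (take n zs))}"
      by (rule shadow_take[OF T(1)])
    also have "\<dots> \<le> emeasure (path_pmf P T x) ({zs. R \<le> gp w (Y (take m zs))} \<union> ?B)"
    proof (intro emeasure_mono subsetI)
      fix zs assume "zs \<in> {zs. R + \<delta> \<le> gp w (Y (take n zs))}"
      then show "zs \<in> {zs. R \<le> gp w (Y (take m zs))} \<union> ?B"
        using gromov_product_trans[OF hyperbolic, of "R + \<delta>" b w "Y (take n zs)" "Y (take m zs)"] R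
        by (cases "zs \<in> ?B") auto
    qed simp
    also have "\<dots> \<le> emeasure (path_pmf P T x) {zs. R \<le> gp w (Y (take m zs))} + emeasure (path_pmf P T x) ?B"
      by (rule emeasure_subadditive) auto
    also have "\<dots> \<le> shadow x w R m + ennreal \<eta>"
      using m0[of n m T] n T
      by (intro add_mono) (auto simp: shadow_take[OF T(2)] measure_pmf.emeasure_eq_measure N_def intro!: ennreal_leI)
    finally show ?thesis .
  qed
  then show ?thesis by blast
qed

text \<open>Up to shifts of the depth by multiples of \<open>\<delta>\<close>, the limsup in
  \<open>atom\<close> behaves like a limit; such shifts are harmless because \<open>atom\<close>
  takes the infimum over all depths.\<close>

lemma atom_le_shadow:
  assumes ws: "conv ws" and "0 < \<eta>"
  shows "\<forall>\<^sub>F m in sequentially. atom x ws \<le> shadow x (ws m) R m + ennreal \<eta>"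
proof -
  obtain N where N: "\<And>n m w. n \<ge> N \<Longrightarrow> m \<ge> N \<Longrightarrow> shadow x w (R + \<delta>) n \<le> shadow x w R m + ennreal \<eta>"
    using shadow_change_time[OF assms(2)] by blast
  obtain N' where N': "\<And>m n. m \<ge> N' \<Longrightarrow> n \<ge> N' \<Longrightarrow> R + \<delta> + \<delta> \<le> gp (ws m) (ws n)"
    using ws unfolding converges_at_infinity_def by blast
  have "atom x ws \<le> shadow x (ws m) R m + ennreal \<eta>" if m: "m \<ge> max N N'" for m
  proof -
    \<comment> \<open>One \<open>\<delta>\<close> pays for the change from \<open>ws n\<close> to
      \<open>ws m\<close>, the other for the change from time \<open>n\<close> to time
      \<open>m\<close>.\<close>
    obtain R' :: nat where R': "R + \<delta> + \<delta> \<le> real R'" using real_arch_simple by blast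
    have "shadow x (ws n) (real R') n \<le> shadow x (ws m) R m + ennreal \<eta>" if n: "n \<ge> max N N'" for n
    proof -
      have "shadow x (ws n) (real R') n \<le> shadow x (ws n) (R + \<delta> + \<delta>) n"
        by (rule shadow_antimono) (rule R')
      also have "\<dots> \<le> shadow x (ws m) (R + \<delta>) n"
        using n m by (intro shadow_change_point N') auto
      also have "\<dots> \<le> shadow x (ws m) R m + ennreal \<eta>"
        using n m by (intro N) auto
      finally show ?thesis .
    qed
    then have "limsup (\<lambda>n. shadow x (ws n) (real R') n) \<le> shadow x (ws m) R m + ennreal \<eta>"
      by (intro Limsup_bounded eventually_sequentiallyI)
    then show ?thesis
      unfolding atom_def by (rule INF_lower2[of R', rotated]) simp
  qed
  then show ?thesis by (rule eventually_sequentiallyI)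
qed

text \<open>With symmetry of the equivalence, this makes \<open>atom\<close> a function of the
  boundary point rather than of the representing sequence.\<close>

lemma atom_equiv_le:
  assumes "infinity_equiv b ws ws'"
  shows "atom x ws \<le> atom x ws'"
  unfolding atom_def[of x ws']
proof (rule INF_greatest)
  fix R :: nat
  obtain R' :: nat where R': "real R + \<delta> \<le> real R'" using real_arch_simple by blast
  obtain N where N: "\<And>n. n \<ge> N \<Longrightarrow> real R + \<delta> \<le> gp (ws n) (ws' n)"
    using assms unfolding infinity_equiv_def by blast
  have "shadow x (ws n) (real R') n \<le> shadow x (ws' n) (real R) n" if "n \<ge> N" for n
    using shadow_antimono[OF R', of x "ws n" n] shadow_change_point[OF N[OF that], of x n] by (rule order_trans)
  then have "limsup (\<lambda>n. shadow x (ws n) (real R') n) \<le> limsup (\<lambda>n. shadow x (ws' n) (real R) n)"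
    by (intro Limsup_mono eventually_sequentiallyI)
  then show "atom x ws \<le> limsup (\<lambda>n. shadow x (ws' n) (real R) n)"
    unfolding atom_def by (rule INF_lower2[of R', rotated]) simp
qed

lemma atom_le_1: "atom x ws \<le> 1"
proof -
  have "limsup (\<lambda>n. shadow x (ws n) (real 0) n) \<le> 1"
    by (intro Limsup_bounded always_eventually allI shadow_le_1)
  then show ?thesis unfolding atom_def by (rule INF_lower2[of 0, rotated]) simp
qed

text \<open>Distinct boundary points have disjoint deep shadows, and finitely many of them can be
  separated at one common time and depth.\<close>

lemma atom_sum_le_1:
  assumes I: "finite I" and conv: "\<And>i. i \<in> I \<Longrightarrow> conv (ws i)"
    and ineq: "\<And>i j. i \<in> I \<Longrightarrow> j \<in> I \<Longrightarrow> i \<noteq> j \<Longrightarrow> \<not> infinity_equiv b (ws i) (ws j)"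
  shows "(\<Sum>i\<in>I. atom x (ws i)) \<le> 1"
proof (rule ennreal_le_epsilon)
  fix e :: real assume e: "0 < e"
  define \<eta> where "\<eta> = e / (real (card I) + 1)"
  have \<eta>: "0 < \<eta>" "real (card I) * \<eta> \<le> e"
    using e by (auto simp: \<eta>_def field_simps)
  have "\<forall>\<^sub>F R in at_top. \<forall>p\<in>I \<times> I. fst p \<noteq> snd p \<longrightarrow>
      (\<forall>\<^sub>F n in sequentially. gp (ws (fst p) n) (ws (snd p) n) < R)"
  proof (intro eventually_ball_finite ballI)
    fix p assume p: "p \<in> I \<times> I"
    show "\<forall>\<^sub>F R in at_top. fst p \<noteq> snd p \<longrightarrow>
      (\<forall>\<^sub>F n in sequentially. gp (ws (fst p) n) (ws (snd p) n) < R)"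
    proof (cases "fst p = snd p")
      case False
      with p have "\<forall>\<^sub>F R in at_top. \<forall>\<^sub>F n in sequentially. gp (ws (fst p) n) (ws (snd p) n) < R"
        by (intro not_infinity_equiv_bounded[OF hyperbolic] conv ineq) auto
      then show ?thesis by (rule eventually_mono) simp
    qed simp
  qed (use I in simp)
  then obtain R where R: "\<forall>p\<in>I \<times> I. fst p \<noteq> snd p \<longrightarrow>
      (\<forall>\<^sub>F n in sequentially. gp (ws (fst p) n) (ws (snd p) n) < R)"
    using eventually_happens'[OF trivial_limit_at_top_linorder] by blast
  have "\<forall>\<^sub>F n in sequentially. \<forall>p\<in>I \<times> I. fst p \<noteq> snd p \<longrightarrow> gp (ws (fst p) n) (ws (snd p) n) < R"
    using R I by (intro eventually_ball_finite ballI) (auto elim!: eventually_mono)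
  moreover have "\<forall>\<^sub>F n in sequentially. \<forall>i\<in>I. atom x (ws i) \<le> shadow x (ws i n) (R + \<delta>) n + ennreal \<eta>"
    using I by (intro eventually_ball_finite ballI atom_le_shadow conv \<eta>) auto
  ultimately have "\<forall>\<^sub>F n in sequentially. (\<forall>p\<in>I \<times> I. fst p \<noteq> snd p \<longrightarrow> gp (ws (fst p) n) (ws (snd p) n) < R) \<and>
      (\<forall>i\<in>I. atom x (ws i) \<le> shadow x (ws i n) (R + \<delta>) n + ennreal \<eta>)"
    by (rule eventually_conj)
  then obtain n where n1: "\<And>i j. i \<in> I \<Longrightarrow> j \<in> I \<Longrightarrow> i \<noteq> j \<Longrightarrow> gp (ws i n) (ws j n) < R"
    and n2: "\<And>i. i \<in> I \<Longrightarrow> atom x (ws i) \<le> shadow x (ws i n) (R + \<delta>) n + ennreal \<eta>"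
    using eventually_happens'[OF sequentially_bot] by fastforce
  let ?A = "\<lambda>i. {zs. R + \<delta> \<le> gp (ws i n) (Y zs)}"
  \<comment> \<open>An inverse walk in two of these shadows would force the product of the two
    points to be at least \<open>R\<close>.\<close>
  have disj: "disjoint_family_on ?A I"
    unfolding disjoint_family_on_def
  proof (intro ballI impI)
    fix i j assume ij: "i \<in> I" "j \<in> I" "i \<noteq> j"
    show "?A i \<inter> ?A j = {}"
      using gromov_product_trans[OF hyperbolic, of "R + \<delta>" b "ws i n" _ "ws j n"] n1[OF ij]
      by (fastforce simp: gromov_product_commute[of b _ "ws j n"])
  qed
  have "(\<Sum>i\<in>I. atom x (ws i)) \<le> (\<Sum>i\<in>I. shadow x (ws i n) (R + \<delta>) n + ennreal \<eta>)"
    by (intro sum_mono n2)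
  also have "\<dots> = (\<Sum>i\<in>I. emeasure (path_pmf P n x) (?A i)) + ennreal (real (card I) * \<eta>)"
    using \<eta> by (simp add: sum.distrib shadow_def ennreal_mult flip: ennreal_of_nat_eq_real_of_nat)
  also have "(\<Sum>i\<in>I. emeasure (path_pmf P n x) (?A i)) = emeasure (path_pmf P n x) (\<Union>i\<in>I. ?A i)"
    by (rule sum_emeasure[OF _ disj I]) auto
  also have "\<dots> \<le> 1" by (rule measure_pmf.subprob_emeasure_le_1)
  also have "ennreal (real (card I) * \<eta>) \<le> ennreal e"
    using \<eta>(2) by (rule ennreal_leI)
  finally show "(\<Sum>i\<in>I. atom x (ws i)) \<le> 1 + ennreal e"
    by (simp add: add_left_mono add_right_mono)
qed

text \<open>Conditioning on the first step \<open>y\<close> moves the target to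
  \<open>X y \<circ> ws\<close>. Reverse Fatou passes the limsup through the integral, and monotone
  convergence does the same for the infimum over depths.\<close>

lemma atom_subharmonic:
  assumes ws: "conv ws"
  shows "atom x ws \<le> (\<integral>\<^sup>+y. atom y (X y \<circ> ws) \<partial>P x)"
proof -
  define \<kappa> where "\<kappa> y = dist (X y b) b" for y
  \<comment> \<open>The first step shifts the base point by \<open>\<kappa> y\<close>, and comparing
    the indices \<open>n + 1\<close> and \<open>n\<close> of \<open>ws\<close> costs
    \<open>\<delta>\<close>. The loss varies with \<open>y\<close>, so the infimum over
    \<open>R\<close> can absorb it only after it is inside the integral.\<close>
  define H where "H R y = limsup (\<lambda>n. shadow y (X y (ws n)) (real R - \<kappa> y - \<delta>) n)" for R :: nat and y
  have le: "atom x ws \<le> (\<integral>\<^sup>+y. H R y \<partial>P x)" for R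
  proof -
    obtain N where N: "\<And>m n. m \<ge> N \<Longrightarrow> n \<ge> N \<Longrightarrow> real R \<le> gp (ws m) (ws n)"
      using ws unfolding converges_at_infinity_def by blast
    have step: "shadow x (ws (n + 1)) (real R) (n + 1) \<le>
        (\<integral>\<^sup>+y. shadow y (X y (ws n)) (real R - \<kappa> y - \<delta>) n \<partial>P x)" if n: "n \<ge> N" for n
    proof -
      have "shadow x (ws (n + 1)) (real R) (n + 1) =
          (\<integral>\<^sup>+y. emeasure (path_pmf P n y) {zs. real R \<le> gp (ws (n + 1)) (Y (y # zs))} \<partial>P x)"
        by (simp add: shadow_def vimage_def)
      also have "\<dots> \<le> (\<integral>\<^sup>+y. shadow y (X y (ws n)) (real R - \<kappa> y - \<delta>) n \<partial>P x)"
      proof (rule nn_integral_mono)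
        fix y
        show "emeasure (path_pmf P n y) {zs. real R \<le> gp (ws (n + 1)) (Y (y # zs))} \<le>
          shadow y (X y (ws n)) (real R - \<kappa> y - \<delta>) n"
          unfolding shadow_def
        proof (intro emeasure_mono subsetI)
          fix zs assume "zs \<in> {zs. real R \<le> gp (ws (n + 1)) (Y (y # zs))}"
          then have "real R \<le> gp (M [y] (ws (n + 1))) (Y zs) + kap [y]"
            using gp_Y_append_le[of "ws (n + 1)" "[y]" zs] by simp
          then have 1: "real R - \<kappa> y \<le> gp (X y (ws (n + 1))) (Y zs)"
            by (simp add: kap_def walk_prod_Cons \<kappa>_def)
          have 2: "real R - \<kappa> y \<le> gp (X y (ws n)) (X y (ws (n + 1)))"
            using gromov_product_isometry_le[OF isom[of y], of b "ws n" "ws (n + 1)"] N[of n "n + 1"] n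
            by (simp add: \<kappa>_def)
          show "zs \<in> {zs. real R - \<kappa> y - \<delta> \<le> gp (X y (ws n)) (Y zs)}"
            using gromov_product_trans[OF hyperbolic 2 1] by simp
        qed simp
      qed
      finally show ?thesis .
    qed
    have "atom x ws \<le> limsup (\<lambda>n. shadow x (ws n) (real R) n)"
      unfolding atom_def by (rule INF_lower) simp
    also have "\<dots> = limsup (\<lambda>n. shadow x (ws (n + 1)) (real R) (n + 1))"
      by (rule limsup_shift[symmetric])
    also have "\<dots> \<le> limsup (\<lambda>n. \<integral>\<^sup>+y. shadow y (X y (ws n)) (real R - \<kappa> y - \<delta>) n \<partial>P x)"
      by (intro Limsup_mono eventually_sequentiallyI step)
    also have "\<dots> \<le> (\<integral>\<^sup>+y. H R y \<partial>P x)"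
      unfolding H_def by (rule nn_integral_limsup[where w="\<lambda>_. 1"]) (auto simp: shadow_le_1)
    finally show ?thesis .
  qed
  have H_le: "H R y \<le> 1" for R y
    unfolding H_def by (intro Limsup_bounded always_eventually allI shadow_le_1)
  have dec: "decseq H"
    unfolding H_def by (intro decseq_SucI le_funI Limsup_mono always_eventually allI shadow_antimono) auto
  have "atom x ws \<le> (INF R. \<integral>\<^sup>+y. H R y \<partial>P x)"
    by (intro INF_greatest le)
  also have "\<dots> = (\<integral>\<^sup>+y. (INF R. H R y) \<partial>P x)"
  proof (rule nn_integral_monotone_convergence_INF_decseq[symmetric, OF dec])
    have "(\<integral>\<^sup>+y. H 0 y \<partial>P x) \<le> 1" by (intro nn_integral_pmf_le_const H_le)
    then show "(\<integral>\<^sup>+y. H 0 y \<partial>P x) < \<infinity>" using le_less_trans[of _ "1::ennreal" top] by simp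
  qed simp
  also have "\<dots> \<le> (\<integral>\<^sup>+y. atom y (X y \<circ> ws) \<partial>P x)"
  proof (rule nn_integral_mono)
    fix y
    show "(INF R. H R y) \<le> atom y (X y \<circ> ws)"
      unfolding atom_def
    proof (rule INF_greatest)
      fix R :: nat
      obtain R' :: nat where "real R + \<kappa> y + \<delta> \<le> real R'" using real_arch_simple by blast
      then have "H R' y \<le> limsup (\<lambda>n. shadow y ((X y \<circ> ws) n) (real R) n)"
        unfolding H_def by (intro Limsup_mono always_eventually allI) (auto intro!: shadow_antimono)
      then show "(INF R. H R y) \<le> limsup (\<lambda>n. shadow y ((X y \<circ> ws) n) (real R) n)"
        by (rule INF_lower2[of R', rotated]) simp
    qed
  qed
  finally show ?thesis .
qed

section \<open>Maximal atoms and the invariant family they form\<close>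

definition max_atom :: "'e \<Rightarrow> ennreal" where
  "max_atom x = (SUP ws\<in>Collect conv. atom x ws)"

lemma max_atom_le_1: "max_atom x \<le> 1"
  unfolding max_atom_def by (intro SUP_least atom_le_1)

lemma atom_le_max_atom: "conv ws \<Longrightarrow> atom x ws \<le> max_atom x"
  unfolding max_atom_def by (rule SUP_upper) simp

lemma max_atom_subharmonic: "max_atom x \<le> (\<integral>\<^sup>+y. max_atom y \<partial>kernel_pow P n x)"
proof (induction n arbitrary: x)
  case 0
  then show ?case by simp
next
  case (Suc n)
  have "max_atom x \<le> (\<integral>\<^sup>+y. max_atom y \<partial>P x)"
    unfolding max_atom_def[of x]
  proof (rule SUP_least)
    fix ws assume ws: "ws \<in> Collect conv"
    then have "atom x ws \<le> (\<integral>\<^sup>+y. atom y (X y \<circ> ws) \<partial>P x)"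
      using atom_subharmonic by simp
    also have "\<dots> \<le> (\<integral>\<^sup>+y. max_atom y \<partial>P x)"
      using ws by (intro nn_integral_mono atom_le_max_atom converges_at_infinity_isometry isom) simp
    finally show "atom x ws \<le> (\<integral>\<^sup>+y. max_atom y \<partial>P x)" .
  qed
  also have "\<dots> \<le> (\<integral>\<^sup>+y. (\<integral>\<^sup>+z. max_atom z \<partial>kernel_pow P n y) \<partial>P x)"
    by (intro nn_integral_mono Suc)
  finally show ?case by simp
qed

text \<open>Subharmonicity and mixing bound every value by the mean under \<open>\<pi>\<close>. A
  function bounded by its own mean equals it wherever \<open>\<pi>\<close> has mass, which is
  everywhere.\<close>

lemma max_atom_const: "max_atom x = (\<integral>\<^sup>+y. max_atom y \<partial>\<pi>)"
proof -
  have le: "max_atom z \<le> (\<integral>\<^sup>+y. max_atom y \<partial>\<pi>)" for z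
  proof (rule ennreal_le_epsilon)
    fix e :: real assume "0 < e"
    then obtain k where k: "tv_dist (kernel_pow P k z) \<pi> \<le> e" using mixing_eventually by blast
    have "max_atom z \<le> (\<integral>\<^sup>+y. max_atom y \<partial>kernel_pow P k z)" by (rule max_atom_subharmonic)
    also have "\<dots> \<le> (\<integral>\<^sup>+y. max_atom y \<partial>\<pi>) + ennreal (1 * tv_dist (kernel_pow P k z) \<pi>)"
      by (rule nn_integral_le_tv) (auto simp: max_atom_le_1)
    also have "\<dots> \<le> (\<integral>\<^sup>+y. max_atom y \<partial>\<pi>) + ennreal e"
      using k by (intro add_left_mono ennreal_leI) simp
    finally show "max_atom z \<le> (\<integral>\<^sup>+y. max_atom y \<partial>\<pi>) + ennreal e" .
  qed
  have "(\<integral>\<^sup>+y. max_atom y \<partial>\<pi>) \<le> 1" by (intro nn_integral_pmf_le_const max_atom_le_1)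
  then have "(\<integral>\<^sup>+y. max_atom y \<partial>\<pi>) \<noteq> \<infinity>" by (auto simp: top_unique)
  then show ?thesis
    using nn_integral_pmf_eq_bound[of max_atom, OF le _ order_refl, of x] pi_pos[of x]
    by (auto simp: set_pmf_iff)
qed

lemma card_atoms_le:
  assumes F: "finite F" and "\<And>i. i \<in> F \<Longrightarrow> conv (ws i)"
    and "\<And>i j. i \<in> F \<Longrightarrow> j \<in> F \<Longrightarrow> i \<noteq> j \<Longrightarrow> \<not> infinity_equiv b (ws i) (ws j)"
    and c: "0 \<le> c" "\<And>i. i \<in> F \<Longrightarrow> ennreal c \<le> atom x (ws i)"
  shows "real (card F) * c \<le> 1"
proof -
  have "ennreal (real (card F) * c) = (\<Sum>i\<in>F. ennreal c)"
    using c(1) by (simp add: ennreal_mult flip: ennreal_of_nat_eq_real_of_nat)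
  also have "\<dots> \<le> (\<Sum>i\<in>F. atom x (ws i))" by (intro sum_mono c)
  also have "\<dots> \<le> 1" by (rule atom_sum_le_1) (use assms in blast)+
  finally show ?thesis by simp
qed

text \<open>Only finitely many values of \<open>atom\<close> exceed half the supremum, since the
  total mass is at most 1; so the supremum is a maximum.\<close>

lemma max_atom_attained:
  assumes "0 < max_atom x"
  shows "\<exists>ws. conv ws \<and> atom x ws = max_atom x"
proof -
  obtain c where c: "max_atom x = ennreal c" "0 \<le> c"
    using max_atom_le_1[of x] by (cases "max_atom x" rule: ennreal_cases) (auto simp: top_unique)
  have cpos: "0 < c" using assms c by simp
  \<comment> \<open>A set of values, not of boundary points: different values have inequivalent
    representatives, so the bound on the number of atoms applies to values as well.\<close>
  define T where "T = {t. ennreal (c / 2) < t \<and> (\<exists>ws. conv ws \<and> atom x ws = t)}"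
  define rep where "rep t = (SOME ws. conv ws \<and> atom x ws = t)" for t
  have rep: "conv (rep t) \<and> atom x (rep t) = t" if "t \<in> T" for t
  proof -
    have "\<exists>ws. conv ws \<and> atom x ws = t" using that by (auto simp: T_def)
    then show ?thesis unfolding rep_def by (rule someI_ex)
  qed
  have "finite T"
  proof (rule finite_by_card_bound[of "c / 2"])
    fix F assume F: "finite F" "F \<subseteq> T"
    show "real (card F) * (c / 2) \<le> 1"
    proof (rule card_atoms_le[of F rep _ x])
      fix i j assume ij: "i \<in> F" "j \<in> F" "i \<noteq> j"
      show "\<not> infinity_equiv b (rep i) (rep j)"
      proof
        assume eq: "infinity_equiv b (rep i) (rep j)"
        have "atom x (rep i) = atom x (rep j)"
          by (intro antisym atom_equiv_le eq infinity_equiv_sym)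
        then show False using ij rep[of i] rep[of j] F(2) by (metis subsetD)
      qed
    next
      fix i assume "i \<in> F"
      then have "i \<in> T" using F by blast
      then show "ennreal (c / 2) \<le> atom x (rep i)" using rep[of i] by (simp add: T_def less_imp_le)
    qed (use F rep cpos in auto)
  qed (use cpos in simp)
  moreover have "ennreal (c / 2) < max_atom x"
    using c cpos by (simp add: ennreal_less_iff)
  then have "\<exists>ws\<in>Collect conv. ennreal (c / 2) < atom x ws"
    unfolding max_atom_def less_SUP_iff .
  then have "T \<noteq> {}" by (auto simp: T_def)
  ultimately have max: "Max T \<in> T" "\<And>t. t \<in> T \<Longrightarrow> t \<le> Max T" by auto
  have "max_atom x \<le> Max T"
    unfolding max_atom_def
  proof (rule SUP_least)
    fix ws assume ws: "ws \<in> Collect conv"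
    show "atom x ws \<le> Max T"
    proof (cases "atom x ws \<in> T")
      case False
      then have "atom x ws \<le> ennreal (c / 2)" using ws by (auto simp: T_def)
      also have "\<dots> < Max T" using max(1) by (auto simp: T_def)
      finally show ?thesis by simp
    qed (rule max)
  qed
  moreover have "Max T \<le> max_atom x"
    using rep[OF max(1)] atom_le_max_atom[of "rep (Max T)" x] by simp
  ultimately show ?thesis using rep[OF max(1)] by (metis antisym)
qed

text \<open>The boundary points of maximal mass form a finite nonempty set \<open>W x\<close>.
  Equality in the subharmonic inequality maps \<open>W x\<close> into \<open>W y\<close> at each
  possible step, and equal cardinalities turn the inclusion into equality.\<close>

lemma elementary_of_atom:
  assumes "conv ws0" "0 < atom x0 ws0"
  shows "\<not> non_elementary P X b"
proof -
  define m where "m = (\<integral>\<^sup>+y. max_atom y \<partial>\<pi>)"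
  have max_atom: "max_atom x = m" for x
    unfolding m_def by (rule max_atom_const)
  have m_pos: "0 < m"
    using assms atom_le_max_atom[OF assms(1), of x0] max_atom[of x0] by simp
  have m_le: "m \<le> 1" using max_atom_le_1[of x0] max_atom by simp
  then have m_fin: "m \<noteq> \<infinity>" by (auto simp: top_unique)
  then obtain c where c: "m = ennreal c" "0 \<le> c"
    by (cases m rule: ennreal_cases) auto
  have cpos: "0 < c" using m_pos c by simp
  define W where "W x = boundary_class b ` {ws. conv ws \<and> atom x ws = m}" for x
  have W_boundary: "W x \<subseteq> gromov_boundary b" for x
    unfolding W_def using boundary_class_in_boundary by blast
  have W_ne: "W x \<noteq> {}" for x
    using max_atom_attained[of x] m_pos by (auto simp: W_def max_atom)
  have W_fin: "finite (W x)" for x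
  proof (rule finite_by_card_bound[OF cpos])
    fix F assume F: "finite F" "F \<subseteq> W x"
    define rep where "rep t = (SOME ws. conv ws \<and> atom x ws = m \<and> boundary_class b ws = t)" for t
    have rep: "conv (rep t) \<and> atom x (rep t) = m \<and> boundary_class b (rep t) = t" if "t \<in> F" for t
    proof -
      have "\<exists>ws. conv ws \<and> atom x ws = m \<and> boundary_class b ws = t" using that F by (auto simp: W_def)
      then show ?thesis unfolding rep_def by (rule someI_ex)
    qed
    show "real (card F) * c \<le> 1"
    proof (rule card_atoms_le[of F rep _ x])
      fix i j assume ij: "i \<in> F" "j \<in> F" "i \<noteq> j"
      show "\<not> infinity_equiv b (rep i) (rep j)"
        using boundary_class_eqI[OF hyperbolic, of b "rep i" "rep j"] rep ij by metis
    qed (use F rep c in auto)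
  qed
  have sub: "boundary_act (X y) ` W x \<subseteq> W y" if y: "y \<in> set_pmf (P x)" for x y
  proof
    fix d assume "d \<in> boundary_act (X y) ` W x"
    then obtain ws where ws: "conv ws" "atom x ws = m" "d = boundary_class b (X y \<circ> ws)"
      by (auto simp: W_def boundary_act_class[OF isom])
    have "atom z (X z \<circ> ws) \<le> m" for z
      using atom_le_max_atom[OF converges_at_infinity_isometry[OF isom ws(1)]] by (simp add: max_atom)
    moreover have "m \<le> (\<integral>\<^sup>+z. atom z (X z \<circ> ws) \<partial>P x)"
      using atom_subharmonic[OF ws(1), of x] ws(2) by simp
    ultimately have "atom y (X y \<circ> ws) = m"
      using nn_integral_pmf_eq_bound[of "\<lambda>z. atom z (X z \<circ> ws)" m "P x" y] m_fin y by simp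
    then show "d \<in> W y"
      using ws converges_at_infinity_isometry[OF isom ws(1)] by (auto simp: W_def)
  qed
  have card_act: "card (boundary_act (X y) ` W x) = card (W x)" for x y
    by (intro card_image inj_on_subset[OF inj_boundary_act[OF isom]]) simp
  have card_step: "card (W x) \<le> card (W y)" if "y \<in> set_pmf (P x)" for x y
    using card_mono[OF W_fin sub[OF that]] card_act by simp
  have card_pow: "card (W x) \<le> card (W y)" if "y \<in> set_pmf (kernel_pow P n x)" for n x y
    using that
  proof (induction n arbitrary: x)
    case (Suc n)
    then obtain z where "z \<in> set_pmf (P x)" "y \<in> set_pmf (kernel_pow P n z)" by auto
    then show ?case using card_step Suc.IH le_trans by blast
  qed simp
  \<comment> \<open>Cardinality cannot decrease along a possible path, and irreducibility joins any
    two states in both directions.\<close>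
  have "card (W x) \<le> card (W y)" for x y
    using irreducible card_pow[of y _ x] unfolding irreducible_kernel_def
    by (metis less_irrefl set_pmf_iff)
  then have card_eq: "card (W x) = card (W y)" for x y
    by (simp add: antisym)
  have act: "boundary_act (X y) ` W x = W y" if "y \<in> set_pmf (P x)" for x y
    by (rule card_subset_eq[OF W_fin sub[OF that]]) (simp add: card_act card_eq[of x y])
  have act_path: "boundary_act (walk_prod X zs) ` W x = W (last (x # zs))" if "zs \<in> set_pmf (path_pmf P n x)" for x n zs
    using that
  proof (induction n arbitrary: x zs)
    case 0
    then show ?case by (simp add: boundary_act_def image_image comp_def)
  next
    case (Suc n)
    then obtain y ys where y: "y \<in> set_pmf (P x)" "ys \<in> set_pmf (path_pmf P n y)" "zs = y # ys" by auto
    have "boundary_act (walk_prod X zs) ` W x = boundary_act (walk_prod X ys) ` boundary_act (X y) ` W x"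
      by (simp add: y walk_prod_Cons boundary_act_comp image_image)
    also have "\<dots> = W (last (y # ys))" using act[OF y(1)] Suc.IH[OF y(2)] by simp
    finally show ?case by (simp add: y)
  qed
  define k where "k = card (W x0)"
  \<comment> \<open>The constant cardinality lets the sets be enumerated by the same number
    \<open>k\<close> of maps, as the definition of an elementary walk asks.\<close>
  have "\<forall>x. \<exists>h. bij_betw h {0..<k} (W x)"
    using ex_bij_betw_nat_finite[OF W_fin] card_eq[of _ x0] unfolding k_def by metis
  then obtain V where V: "\<And>x. bij_betw (V x) {0..<k} (W x)" by metis
  have VW: "{V x i |i. i < k} = W x" for x
  proof -
    have "{V x i |i. i < k} = V x ` {0..<k}" by auto
    then show ?thesis using V[of x] by (simp add: bij_betw_def)
  qed
  have "k \<ge> 1" using W_ne[of x0] W_fin[of x0] by (simp add: k_def Suc_le_eq card_gt_0_iff)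
  moreover have "\<forall>i<k. \<forall>x. V x i \<in> gromov_boundary b"
  proof (intro allI impI)
    fix i x assume "i < k"
    then have "V x i \<in> W x" using VW[of x] by blast
    then show "V x i \<in> gromov_boundary b" using W_boundary by blast
  qed
  moreover have "\<forall>x n. AE zs in measure_pmf (path_pmf P n x).
     boundary_act (walk_prod X zs) ` {V x i |i. i < k} = {V (last (x # zs)) i |i. i < k}"
    unfolding VW AE_measure_pmf_iff using act_path by blast
  ultimately show ?thesis
    unfolding non_elementary_def Let_def not_not
    by (intro exI[of _ k] exI[of _ "\<lambda>i x. V x i"] conjI)
qed

text \<open>On an infinite set of times with pairwise small Gromov products of the \<open>w n\<close>, the Cauchy
  property would make the events behind the shadows almost disjoint, although each has probability
  at least \<open>c\<close>. So Ramsey's theorem yields a subsequence of \<open>w\<close> converging to a boundary point.\<close>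

lemma atom_of_large_shadows:
  assumes J: "infinite J" and c: "0 < c" and \<epsilon>: "0 < \<epsilon>"
    and large: "\<And>n. n \<in> J \<Longrightarrow> ennreal c \<le> shadow y (w n) (\<epsilon> * real n) n"
  shows "\<exists>ws. conv ws \<and> 0 < atom y ws"
proof -
  \<comment> \<open>With \<open>j * c \<ge> 2\<close> and \<open>j\<^sup>2 * \<eta> = 1 / 2\<close>,
    the Bonferroni bound for \<open>j\<close> events is at least 3/2, which no probability
    reaches.\<close>
  define j where "j = nat \<lceil>2 / c\<rceil> + 1"
  define \<eta> where "\<eta> = 1 / (2 * (real j)\<^sup>2)"
  have j: "j \<ge> 1" "2 \<le> real j * c"
  proof -
    have "2 / c \<le> real j" unfolding j_def by linarith
    then show "2 \<le> real j * c" using c by (simp add: field_simps)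
  qed (simp add: j_def)
  have \<eta>: "0 < \<eta>" "(real j)\<^sup>2 * \<eta> = 1 / 2"
    using j by (auto simp: \<eta>_def)
  obtain m0 where m0: "\<And>m m' T. m \<ge> m0 \<Longrightarrow> m' \<ge> m0 \<Longrightarrow> m \<le> T \<Longrightarrow> m' \<le> T \<Longrightarrow>
    measure_pmf.prob (path_pmf P T y)
      {zs. gp (Y (take m zs)) (Y (take m' zs)) < real (min m m') * speed / 2 - \<delta>} \<le> \<eta>"
    using inverse_walk_cauchy[OF speed_pos \<eta>(1)] by blast
  \<comment> \<open>The depth to which both links are controlled at time \<open>n\<close>: from the
    point to the inverse walk, and from there to the inverse walk at a later time.\<close>
  define q where "q n = min (\<epsilon> * real n) (real n * speed / 2 - \<delta>)" for n
  have q_mono: "q n \<le> q n'" if "n \<le> n'" for n n'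
    unfolding q_def using that \<epsilon> speed_pos
    by (intro min.mono diff_right_mono divide_right_mono mult_left_mono mult_right_mono) auto
  \<comment> \<open>The chain from \<open>w n\<close> over two inverse walks to \<open>w n'\<close>
    uses the hyperbolic inequality twice, hence \<open>2 * \<delta>\<close>. The condition
    \<open>n < n'\<close> gives an unordered pair a well-defined colour.\<close>
  define col where "col S = (if \<exists>n\<in>S. \<exists>n'\<in>S. n < n' \<and> q n - 2 * \<delta> \<le> gp (w n) (w n') then 1 else 0::nat)" for S
  have "infinite (J - {..<m0})" using J by simp
  moreover have "\<forall>n\<in>J - {..<m0}. \<forall>n'\<in>J - {..<m0}. n \<noteq> n' \<longrightarrow> col {n, n'} < 2"
    by (simp add: col_def)
  ultimately obtain Z t where Z: "Z \<subseteq> J - {..<m0}" "infinite Z" and t: "t < 2"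
    and col: "\<And>n n'. n \<in> Z \<Longrightarrow> n' \<in> Z \<Longrightarrow> n \<noteq> n' \<Longrightarrow> col {n, n'} = t"
    using Ramsey2[of "J - {..<m0}" col 2] by blast
  have "t \<noteq> 0"
  proof
    assume t0: "t = 0"
    obtain F where F: "finite F" "card F = j" "F \<subseteq> Z"
      using infinite_arbitrarily_large[OF Z(2)] by blast
    define T where "T = Max F"
    have T: "n \<le> T" if "n \<in> F" for n using F that by (simp add: T_def)
    define A where "A n = {zs. \<epsilon> * real n \<le> gp (w n) (Y (take n zs))}" for n
    have small: "measure_pmf.prob (path_pmf P T y) (A n \<inter> A n') \<le> \<eta>" if n: "n \<in> F" "n' \<in> F" "n < n'" for n n'
    proof -
      have "gp (w n) (w n') < q n - 2 * \<delta>"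
      proof -
        have "col {n, n'} = 0" using col[of n n'] n F t0 by auto
        then show ?thesis using n by (auto simp: col_def not_le split: if_splits)
      qed
      then have "A n \<inter> A n' \<subseteq> {zs. gp (Y (take n zs)) (Y (take n' zs)) < real (min n n') * speed / 2 - \<delta>}"
      proof (intro subsetI CollectI, rule_tac ccontr)
        fix zs assume lt: "gp (w n) (w n') < q n - 2 * \<delta>" and zs: "zs \<in> A n \<inter> A n'"
          and "\<not> gp (Y (take n zs)) (Y (take n' zs)) < real (min n n') * speed / 2 - \<delta>"
        then have YY: "q n \<le> gp (Y (take n zs)) (Y (take n' zs))"
          using n by (simp add: q_def)
        have 1: "q n \<le> gp (w n) (Y (take n zs))"
          using zs by (auto simp: A_def q_def min_def)
        have "q n' \<le> gp (w n') (Y (take n' zs))"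
          using zs by (auto simp: A_def q_def min_def)
        then have 2: "q n - \<delta> \<le> gp (Y (take n' zs)) (w n')"
          using q_mono[of n n'] n delta_nonneg by (simp add: gromov_product_commute)
        have "q n - \<delta> - \<delta> \<le> gp (w n) (w n')"
          by (rule gromov_product_trans[OF hyperbolic gromov_product_trans[OF hyperbolic 1 YY] 2])
        then show False using lt by simp
      qed
      then have "measure_pmf.prob (path_pmf P T y) (A n \<inter> A n') \<le> measure_pmf.prob (path_pmf P T y)
          {zs. gp (Y (take n zs)) (Y (take n' zs)) < real (min n n') * speed / 2 - \<delta>}"
        by (intro measure_pmf.finite_measure_mono) auto
      also have "\<dots> \<le> \<eta>"
        using n F(3) Z(1) by (intro m0 T) auto
      finally show ?thesis .
    qed
    have "real (card F) * c - (real (card F))\<^sup>2 * \<eta> \<le> measure_pmf.prob (path_pmf P T y) (\<Union>n\<in>F. A n)"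
    proof (rule bonferroni_lower_bound[OF F(1)])
      show "0 \<le> \<eta>" using \<eta> by simp
    next
      fix n assume n: "n \<in> F"
      then have "ennreal c \<le> shadow y (w n) (\<epsilon> * real n) n" using F Z by (intro large) auto
      also have "\<dots> = emeasure (path_pmf P T y) (A n)"
        unfolding A_def by (rule shadow_take) (rule T[OF n])
      finally show "c \<le> measure_pmf.prob (path_pmf P T y) (A n)"
        by (simp add: measure_pmf.emeasure_eq_measure)
    next
      fix n n' assume n: "n \<in> F" "n' \<in> F" "n \<noteq> n'"
      show "measure_pmf.prob (path_pmf P T y) (A n \<inter> A n') \<le> \<eta>"
        using small[of n n'] small[of n' n] n by (cases "n < n'") (auto simp: Int_commute)
    qed
    also have "\<dots> \<le> 1" by simp
    finally show False using F(2) j \<eta> by simp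
  qed
  then have t1: "t = 1" using t by simp
  have good: "q n - 2 * \<delta> \<le> gp (w n) (w n')" if "n \<in> Z" "n' \<in> Z" "n < n'" for n n'
  proof -
    have "col {n, n'} = 1" using col[of n n'] that t1 by auto
    then show ?thesis using that by (auto simp: col_def split: if_splits)
  qed
  define e where "e = enumerate Z"
  have e: "strict_mono e" "e i \<in> Z" "i \<le> e i" for i
    using Z(2) by (auto simp: e_def strict_mono_enumerate enumerate_in_set le_enumerate)
  define v where "v i = w (e i)" for i
  have q_large: "\<exists>N. \<forall>n\<ge>N. K \<le> q n - 2 * \<delta>" for K
  proof -
    define N where "N = max (nat \<lceil>(K + 2 * \<delta>) / \<epsilon>\<rceil>) (nat \<lceil>2 * (K + 3 * \<delta>) / speed\<rceil>)"
    have "K \<le> q n - 2 * \<delta>" if "n \<ge> N" for n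
    proof -
      have "(K + 2 * \<delta>) / \<epsilon> \<le> real n" "2 * (K + 3 * \<delta>) / speed \<le> real n"
        using that by (auto simp: N_def)
      then have "K + 2 * \<delta> \<le> \<epsilon> * real n" "K + 3 * \<delta> \<le> real n * speed / 2"
        using \<epsilon> speed_pos by (simp_all add: field_simps)
      then show ?thesis by (simp add: q_def)
    qed
    then show ?thesis by blast
  qed
  have conv: "conv v"
    unfolding converges_at_infinity_def
  proof
    fix K
    obtain N where N: "\<And>n. n \<ge> N \<Longrightarrow> K \<le> q n - 2 * \<delta>" using q_large by blast
    have lt: "K \<le> gp (v m) (v n)" if "m \<ge> N" "m < n" for m n
      using N[of "e m"] e(3)[of m] that good[of "e m" "e n"] e(2) strict_monoD[OF e(1), of m n]
      by (auto simp: v_def)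
    have "K \<le> gp (v m) (v n)" if "m \<ge> N" "n \<ge> N" for m n
    proof (cases m n rule: linorder_cases)
      case less
      then show ?thesis using lt that by blast
    next
      case greater
      then show ?thesis using lt[of n m] that by (simp add: gromov_product_commute)
    next
      \<comment> \<open>The product of a point with itself is its distance to \<open>b\<close>,
        which bounds its product with the next term.\<close>
      case equal
      have "K \<le> gp (v m) (v (Suc m))" using lt[of m "Suc m"] that by simp
      also have "\<dots> \<le> dist b (v m)" by (rule gromov_product_le_dist1)
      also have "\<dots> = gp (v m) (v n)" using equal by (simp add: gromov_product_def)
      finally show ?thesis .
    qed
    then show "\<exists>N. \<forall>m\<ge>N. \<forall>n\<ge>N. K \<le> gp (v m) (v n)" by blast
  qed
  have "ennreal (c / 2) \<le> atom y v"
    unfolding atom_def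
  proof (rule INF_greatest)
    fix R :: nat
    have "0 < c / 2" using c by simp
    from shadow_change_time[OF this, of y "real R"] obtain N where N:
      "\<And>n m u. n \<ge> N \<Longrightarrow> m \<ge> N \<Longrightarrow> shadow y u (real R + \<delta>) n \<le> shadow y u (real R) m + ennreal (c / 2)"
      by blast
    obtain N' where N': "\<And>n. n \<ge> N' \<Longrightarrow> real R + \<delta> \<le> q n - 2 * \<delta>" using q_large by blast
    \<comment> \<open>\<open>v i\<close> is a point chosen for time \<open>e i\<close>, whereas
      \<open>atom\<close> evaluates its shadow at time \<open>i\<close>; the change of time costs
      half of \<open>c\<close>.\<close>
    have "ennreal (c / 2) \<le> shadow y (v i) (real R) i" if i: "i \<ge> max N N'" for i
    proof -
      have "real R + \<delta> \<le> \<epsilon> * real (e i)"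
        using N'[of "e i"] e(3)[of i] i delta_nonneg by (auto simp: q_def)
      then have "shadow y (v i) (\<epsilon> * real (e i)) (e i) \<le> shadow y (v i) (real R + \<delta>) (e i)"
        by (rule shadow_antimono)
      also have "\<dots> \<le> shadow y (v i) (real R) i + ennreal (c / 2)"
        using i e(3)[of i] by (intro N) auto
      finally have "ennreal c \<le> shadow y (v i) (real R) i + ennreal (c / 2)"
        using large[of "e i"] e(2)[of i] Z(1) by (auto simp: v_def intro: order_trans)
      moreover have "ennreal c = ennreal (c / 2) + ennreal (c / 2)"
        using c by (simp flip: ennreal_plus)
      ultimately show ?thesis by (simp add: add.commute)
    qed
    then have "ennreal (c / 2) \<le> liminf (\<lambda>i. shadow y (v i) (real R) i)"
      by (intro Liminf_bounded eventually_sequentiallyI)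
    also have "\<dots> \<le> limsup (\<lambda>i. shadow y (v i) (real R) i)"
      by (rule Liminf_le_Limsup) simp
    finally show "ennreal (c / 2) \<le> limsup (\<lambda>i. shadow y (v i) (real R) i)" .
  qed
  then have "0 < atom y v" using c by (auto intro: less_le_trans[rotated])
  then show ?thesis using conv by blast
qed

section \<open>Uniform vanishing of shadows and the drift\<close>

lemma prob_kap_ge:
  assumes "0 < s"
  shows "emeasure (path_pmf P k x) {us. s \<le> kap us} \<le> ennreal (akap k / s)"
proof -
  have "emeasure (path_pmf P k x) {us. s \<le> kap us} = (\<integral>\<^sup>+us. indicator {us. s \<le> kap us} us \<partial>path_pmf P k x)"
    by simp
  also have "\<dots> \<le> (\<integral>\<^sup>+us. ennreal (1 / s) * ennreal (kap us) \<partial>path_pmf P k x)"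
    using assms by (intro nn_integral_mono) (auto simp: indicator_def simp flip: ennreal_mult)
  also have "\<dots> = ennreal (1 / s) * ennreal (ekap k x)"
    by (simp add: nn_integral_cmult nn_integral_kap)
  also have "\<dots> \<le> ennreal (akap k / s)"
    using assms ekap_le_akap[of k x] by (simp add: divide_right_mono ennreal_leI flip: ennreal_mult)
  finally show ?thesis .
qed

text \<open>Otherwise \<open>k\<close> mixing steps replace the varying starting states by
  \<open>\<pi>\<close>, and reverse Fatou singles out one state with large shadows at infinitely
  many times. That state would see an atom.\<close>

lemma shadows_vanish:
  assumes nonel: "non_elementary P X b" and \<epsilon>: "0 < \<epsilon>" and c: "0 < c"
  shows "\<exists>n0. \<forall>n\<ge>n0. \<forall>x w. shadow x w (\<epsilon> * real n) n \<le> ennreal c"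
proof (rule ccontr)
  assume "\<not> ?thesis"
  then have bad: "\<And>n0. \<exists>n\<ge>n0. \<exists>x w. ennreal c < shadow x w (\<epsilon> * real n) n"
    by (meson not_le)
  have "0 < c / 4" using c by simp
  from mixing_eventually[OF this] obtain k where k: "\<And>z. tv_dist (kernel_pow P k z) \<pi> \<le> c / 4" by blast
  \<comment> \<open>After the first \<open>k\<close> steps the point is the random
    \<open>M us w\<close>, hence the supremum. Half of \<open>\<epsilon>\<close> is given up for the
    distance \<open>kap us\<close> covered in these steps.\<close>
  define g where "g n z = (SUP w. shadow z w (\<epsilon> / 2 * real n) n)" for n z
  have g_le: "g n z \<le> 1" for n z
    unfolding g_def by (intro SUP_least shadow_le_1)
  have upper: "shadow x w (\<epsilon> * real (k + n)) (k + n) \<le> (\<integral>\<^sup>+z. g n z \<partial>\<pi>) + ennreal (c / 2)"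
    if n: "n \<ge> 1" "8 * akap k / (\<epsilon> * c) \<le> real n" for n x w
  proof -
    let ?K = "{us. \<epsilon> / 2 * real n \<le> kap us}"
    have "shadow x w (\<epsilon> * real (k + n)) (k + n) =
        (\<integral>\<^sup>+us. emeasure (path_pmf P n (last (x # us))) {vs. \<epsilon> * real (k + n) \<le> gp w (Y (us @ vs))} \<partial>path_pmf P k x)"
      unfolding shadow_def path_pmf_append by (simp add: vimage_def)
    also have "\<dots> \<le> (\<integral>\<^sup>+us. indicator ?K us + g n (last (x # us)) \<partial>path_pmf P k x)"
    proof (rule nn_integral_mono)
      fix us
      show "emeasure (path_pmf P n (last (x # us))) {vs. \<epsilon> * real (k + n) \<le> gp w (Y (us @ vs))}
          \<le> indicator ?K us + g n (last (x # us))"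
      proof (cases "us \<in> ?K")
        case True
        then show ?thesis
          using measure_pmf.subprob_emeasure_le_1[of "path_pmf P n (last (x # us))"]
          by (simp add: add_increasing2 del: last.simps)
      next
        case False
        have "emeasure (path_pmf P n (last (x # us))) {vs. \<epsilon> * real (k + n) \<le> gp w (Y (us @ vs))}
            \<le> shadow (last (x # us)) (M us w) (\<epsilon> / 2 * real n) n"
          unfolding shadow_def
        proof (intro emeasure_mono subsetI)
          fix vs assume "vs \<in> {vs. \<epsilon> * real (k + n) \<le> gp w (Y (us @ vs))}"
          then have "\<epsilon> * real (k + n) \<le> gp (M us w) (Y vs) + kap us"
            using gp_Y_append_le[of w us vs] by simp
          moreover have "\<epsilon> * real n \<le> \<epsilon> * real (k + n)"
            using \<epsilon> by (intro mult_left_mono) auto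
          moreover have "\<epsilon> * real n = \<epsilon> / 2 * real n + \<epsilon> / 2 * real n" by simp
          ultimately show "vs \<in> {zs. \<epsilon> / 2 * real n \<le> gp (M us w) (Y zs)}"
            using False by (simp only: mem_Collect_eq not_le)
        qed simp
        also have "\<dots> \<le> g n (last (x # us))"
          unfolding g_def by (rule SUP_upper) simp
        finally show ?thesis by (simp add: add_increasing)
      qed
    qed
    also have "\<dots> = emeasure (path_pmf P k x) ?K + (\<integral>\<^sup>+us. g n (last (x # us)) \<partial>path_pmf P k x)"
      by (simp add: nn_integral_add del: last.simps)
    also have "(\<integral>\<^sup>+us. g n (last (x # us)) \<partial>path_pmf P k x) = (\<integral>\<^sup>+z. g n z \<partial>kernel_pow P k x)"
      by (rule nn_integral_last_path)
    also have "\<dots> \<le> (\<integral>\<^sup>+z. g n z \<partial>\<pi>) + ennreal (1 * tv_dist (kernel_pow P k x) \<pi>)"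
      by (rule nn_integral_le_tv) (auto simp: g_le)
    also have "\<dots> \<le> (\<integral>\<^sup>+z. g n z \<partial>\<pi>) + ennreal (c / 4)"
      using k by (intro add_left_mono ennreal_leI) simp
    also have "emeasure (path_pmf P k x) ?K \<le> ennreal (akap k / (\<epsilon> / 2 * real n))"
      using \<epsilon> n by (intro prob_kap_ge) simp
    also have "\<dots> \<le> ennreal (c / 4)"
      using \<epsilon> n c by (intro ennreal_leI) (simp add: field_simps)
    also have "ennreal (c / 4) + ((\<integral>\<^sup>+z. g n z \<partial>\<pi>) + ennreal (c / 4)) = (\<integral>\<^sup>+z. g n z \<partial>\<pi>) + (ennreal (c / 4) + ennreal (c / 4))"
      by (simp only: ac_simps)
    also have "ennreal (c / 4) + ennreal (c / 4) = ennreal (c / 2)"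
      using c by (simp flip: ennreal_plus)
    finally show ?thesis by (simp add: add_left_mono add_right_mono)
  qed
  have often: "\<exists>n\<ge>N. ennreal (c / 2) \<le> (\<integral>\<^sup>+z. g n z \<partial>\<pi>)" for N
  proof -
    \<comment> \<open>For such \<open>n\<close> Markov's inequality bounds the probability that the
      first \<open>k\<close> steps travel at least \<open>\<epsilon> / 2 * n\<close> by
      \<open>c / 4\<close>.\<close>
    define N1 where "N1 = max N (max 1 (nat \<lceil>8 * akap k / (\<epsilon> * c)\<rceil>))"
    obtain n' x w where n': "n' \<ge> k + N1" "ennreal c < shadow x w (\<epsilon> * real n') n'" using bad by blast
    define n where "n = n' - k"
    have n: "n' = k + n" "n \<ge> N1" using n' by (auto simp: n_def)
    then have "n \<ge> 1" "8 * akap k / (\<epsilon> * c) \<le> real n" "n \<ge> N"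
      by (auto simp: N1_def)
    then have "ennreal c \<le> (\<integral>\<^sup>+z. g n z \<partial>\<pi>) + ennreal (c / 2)"
      using upper[of n x w] n' n by (simp del: of_nat_add)
    moreover have "ennreal c = ennreal (c / 2) + ennreal (c / 2)"
      using c by (simp flip: ennreal_plus)
    ultimately have "ennreal (c / 2) \<le> (\<integral>\<^sup>+z. g n z \<partial>\<pi>)" by (simp add: add.commute)
    then show ?thesis using \<open>n \<ge> N\<close> by blast
  qed
  have "ennreal (c / 2) \<le> limsup (\<lambda>n. \<integral>\<^sup>+z. g n z \<partial>\<pi>)"
    unfolding limsup_INF_SUP
  proof (rule INF_greatest)
    fix N
    obtain n where "n \<ge> N" "ennreal (c / 2) \<le> (\<integral>\<^sup>+z. g n z \<partial>\<pi>)" using often by blast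
    then show "ennreal (c / 2) \<le> (SUP m\<in>{N..}. \<integral>\<^sup>+z. g m z \<partial>\<pi>)" by (intro SUP_upper2[of n]) auto
  qed
  also have "\<dots> \<le> (\<integral>\<^sup>+z. limsup (\<lambda>n. g n z) \<partial>\<pi>)"
    by (rule nn_integral_limsup[where w="\<lambda>_. 1"]) (auto simp: g_le)
  finally have lim: "ennreal (c / 2) \<le> (\<integral>\<^sup>+z. limsup (\<lambda>n. g n z) \<partial>\<pi>)" .
  have "\<exists>y. ennreal (c / 4) < limsup (\<lambda>n. g n y)"
  proof (rule ccontr)
    assume "\<not> ?thesis"
    then have "(\<integral>\<^sup>+z. limsup (\<lambda>n. g n z) \<partial>\<pi>) \<le> ennreal (c / 4)"
      by (intro nn_integral_pmf_le_const) (auto simp: not_less)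
    then have "ennreal (c / 2) \<le> ennreal (c / 4)" using lim by (rule order_trans[rotated])
    then show False using c by simp
  qed
  then obtain y where y: "ennreal (c / 4) < limsup (\<lambda>n. g n y)" by blast
  define J where "J = {n. ennreal (c / 4) < g n y}"
  have "infinite J"
  proof
    assume "finite J"
    then have "\<forall>\<^sub>F n in sequentially. n \<notin> J"
      using finite_nat_bounded[of J] by (metis eventually_sequentiallyI lessThan_iff not_le subsetD)
    then have "limsup (\<lambda>n. g n y) \<le> ennreal (c / 4)"
      by (intro Limsup_bounded) (auto simp: J_def not_less elim: eventually_mono)
    then show False using y by simp
  qed
  have "\<forall>n\<in>J. \<exists>w. ennreal (c / 4) \<le> shadow y w (\<epsilon> / 2 * real n) n"
    unfolding J_def g_def by (auto simp: less_SUP_iff intro: less_imp_le)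
  then obtain w where w: "\<And>n. n \<in> J \<Longrightarrow> ennreal (c / 4) \<le> shadow y (w n) (\<epsilon> / 2 * real n) n"
    by metis
  obtain ws where "conv ws" "0 < atom y ws"
    using atom_of_large_shadows[OF \<open>infinite J\<close> _ _ w] c \<epsilon> by auto
  then show False using elementary_of_atom nonel by blast
qed

text \<open>By \<open>gp_Y\<close> it suffices to bound the mean of the Gromov product: it is below
  \<open>\<epsilon>1 * N\<close> off the shadow, and on this rare event it is at most
  \<open>kap\<close>, which the excess controls.\<close>

lemma drift_lower_bound:
  assumes nonel: "non_elementary P X b" and \<epsilon>: "0 < \<epsilon>"
  shows "\<exists>N\<ge>1. \<forall>x w. real N * (speed - \<epsilon>) \<le> measure_pmf.expectation (path_pmf P N x) (disp w)"
proof -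
  define \<epsilon>1 where "\<epsilon>1 = min 1 (\<epsilon> / 10)"
  \<comment> \<open>Since \<open>\<epsilon>1 \<le> 1\<close>, an event of probability
    \<open>c\<close> contributes at most \<open>N * \<epsilon>1\<close> to the mean of the truncated
    length. The errors add up to seven \<open>\<epsilon>1\<close>, within the ten allowed.\<close>
  define c where "c = \<epsilon>1 / (speed + 1)"
  have e1: "0 < \<epsilon>1" "\<epsilon>1 \<le> 1" "10 * \<epsilon>1 \<le> \<epsilon>" using \<epsilon> by (auto simp: \<epsilon>1_def)
  have c: "0 < c" "c * (speed + 1) = \<epsilon>1" using e1 speed_pos by (auto simp: c_def)
  obtain N1 where N1: "\<And>n x w. n \<ge> N1 \<Longrightarrow> shadow x w (\<epsilon>1 * real n) n \<le> ennreal c"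
    using shadows_vanish[OF nonel e1(1) c(1)] by blast
  obtain N2 where N2: "\<And>n x. n \<ge> N2 \<Longrightarrow> real n * (speed - \<epsilon>1) \<le> ekap n x"
    using ekap_lower[OF e1(1)] by blast
  obtain N3 where N3: "\<And>n x. n \<ge> N3 \<Longrightarrow> (\<integral>\<^sup>+zs. ennreal (excess \<epsilon>1 n zs) \<partial>path_pmf P n x) \<le> ennreal (\<epsilon>1 * real n)"
    using excess_small[OF e1(1)] by blast
  define N where "N = max 1 (max N1 (max N2 N3))"
  have N: "N \<ge> 1" "N \<ge> N1" "N \<ge> N2" "N \<ge> N3" by (auto simp: N_def)
  have "real N * (speed - \<epsilon>) \<le> measure_pmf.expectation (path_pmf P N x) (disp w)" for x w
  proof -
    let ?E = "measure_pmf.expectation (path_pmf P N x)"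
    let ?A = "{zs. \<epsilon>1 * real N \<le> gp w (Y zs)}"
    have int_ex: "integrable (path_pmf P N x) (excess \<epsilon>1 N)"
      using N3[OF N(4), of x] by (intro integrableI_nonneg) (auto simp: excess_def less_top[symmetric] top_unique)
    have ex: "?E (excess \<epsilon>1 N) \<le> \<epsilon>1 * real N"
      using N3[OF N(4), of x] e1 by (intro integral_real_bounded) auto
    have ind: "integrable (path_pmf P N x) (\<lambda>zs. indicat_real ?A zs)"
      by (intro measure_pmf.integrable_const_bound[of _ 1]) (auto simp: indicator_def)
    have prob: "measure_pmf.prob (path_pmf P N x) ?A \<le> c"
      using N1[OF N(2), of x w] c by (simp add: shadow_def measure_pmf.emeasure_eq_measure)
    have pt: "kap zs - 2 * (\<epsilon>1 * real N + real N * (speed + \<epsilon>1) * indicat_real ?A zs + excess \<epsilon>1 N zs) \<le> disp w zs" for zs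
    proof -
      have "gp w (Y zs) \<le> \<epsilon>1 * real N + real N * (speed + \<epsilon>1) * indicat_real ?A zs + excess \<epsilon>1 N zs"
      proof (cases "zs \<in> ?A")
        case True
        have "gp w (Y zs) \<le> kap zs" by (rule gp_Y_le)
        moreover have "0 \<le> \<epsilon>1 * real N" using e1 by simp
        ultimately show ?thesis using True by (simp add: excess_def)
      next
        case False
        then show ?thesis by (auto simp: excess_def)
      qed
      then show ?thesis by (simp add: gp_Y field_simps)
    qed
    have "?E (\<lambda>zs. kap zs - 2 * (\<epsilon>1 * real N + real N * (speed + \<epsilon>1) * indicat_real ?A zs + excess \<epsilon>1 N zs)) \<le> ?E (disp w)"
      by (intro integral_mono pt integrable_disp Bochner_Integration.integrable_diff integrable_kap
          integrable_mult_right Bochner_Integration.integrable_add ind int_ex measure_pmf.integrable_const)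
    moreover have "?E (\<lambda>zs. kap zs - 2 * (\<epsilon>1 * real N + real N * (speed + \<epsilon>1) * indicat_real ?A zs + excess \<epsilon>1 N zs))
        = ekap N x - 2 * (\<epsilon>1 * real N + real N * (speed + \<epsilon>1) * measure_pmf.prob (path_pmf P N x) ?A + ?E (excess \<epsilon>1 N))"
      using ind int_ex integrable_kap by (simp add: ekap_def)
    moreover have "real N * (speed + \<epsilon>1) * measure_pmf.prob (path_pmf P N x) ?A \<le> real N * \<epsilon>1"
    proof -
      have "(speed + \<epsilon>1) * measure_pmf.prob (path_pmf P N x) ?A \<le> (speed + 1) * c"
        using prob e1 speed_pos by (intro mult_mono) auto
      then show ?thesis using c(2) by (simp add: mult.assoc mult_left_mono mult.commute[of "speed + 1"])
    qed
    ultimately have "ekap N x - 6 * (\<epsilon>1 * real N) \<le> ?E (disp w)"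
      using ex by (simp add: mult.commute)
    moreover have "real N * (10 * \<epsilon>1) \<le> real N * \<epsilon>"
      using e1 by (intro mult_left_mono) auto
    moreover have "0 \<le> real N * \<epsilon>1" using e1 by simp
    ultimately show ?thesis
      using N2[OF N(3), of x] by (simp add: algebra_simps)
  qed
  then show ?thesis using N(1) by blast
qed

end

section \<open>Large deviations\<close>

context ergodic_walk
begin

text \<open>Positive speed is the case just treated; at speed zero the mean displacement is at least
  \<open>- ekap\<close>, hence at least \<open>- N * \<epsilon>\<close>.\<close>

lemma drift_eventually:
  assumes nonel: "non_elementary P X b" and \<epsilon>: "0 < \<epsilon>"
  shows "\<exists>N\<ge>1. \<forall>x w. real N * (speed - \<epsilon>) \<le> measure_pmf.expectation (path_pmf P N x) (disp w)"
proof (cases "0 < speed")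
  case True
  then interpret transient_walk P X b a B \<pi> C \<rho> \<delta>
    by unfold_locales
  show ?thesis by (rule drift_lower_bound[OF assms])
next
  case False
  then have l: "speed = 0" using speed_nonneg by simp
  obtain N where N: "\<And>n x. n \<ge> N \<Longrightarrow> ekap n x \<le> real n * (speed + \<epsilon>)"
    using ekap_upper[OF \<epsilon>] by blast
  have "real (max 1 N) * (speed - \<epsilon>) \<le> measure_pmf.expectation (path_pmf P (max 1 N) x) (disp w)" for x w
    using N[of "max 1 N" x] expectation_disp_le[of "max 1 N" x w] l by simp
  then show ?thesis by (intro exI[of _ "max 1 N"]) auto
qed

text \<open>The Chernoff bound is applied with \<open>t = - 1\<close> to the drift bound from below
  and with \<open>t = 1\<close> to \<open>ekap_upper\<close>, each with
  \<open>\<epsilon> / 2\<close> to spare.\<close>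

lemma disp_large_deviation:
  assumes nonel: "non_elementary P X b" and \<epsilon>: "0 < \<epsilon>"
  shows "\<exists>\<alpha>>0. \<exists>K>0. \<forall>x w n. measure_pmf.prob (path_pmf P n x)
    {zs. real n * \<epsilon> \<le> \<bar>disp w zs - real n * speed\<bar>} \<le> K * exp (- \<alpha> * real n)"
proof -
  have \<epsilon>2: "0 < \<epsilon> / 2" using \<epsilon> by simp
  obtain N where N: "N \<ge> 1" "\<And>x w. real N * (speed - \<epsilon> / 2) \<le> measure_pmf.expectation (path_pmf P N x) (disp w)"
    using drift_eventually[OF nonel \<epsilon>2] by blast
  have drift1: "- 1 * measure_pmf.expectation (path_pmf P N x) (disp w) \<le> real N * (\<epsilon> / 2 - speed)" for x w
    using N(2)[of x w] by (simp add: algebra_simps)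
  obtain \<alpha>1 K1 where low: "0 < \<alpha>1" "0 < K1"
    "\<And>x w n. measure_pmf.prob (path_pmf P n x) {zs. real n * (\<epsilon> - speed) \<le> - 1 * disp w zs} \<le> K1 * exp (- \<alpha>1 * real n)"
    by (rule large_deviation_drift[OF N(1) _ _ drift1, of "\<epsilon> - speed"]) (use \<epsilon> in auto)
  obtain N' where N': "\<And>n x. n \<ge> N' \<Longrightarrow> ekap n x \<le> real n * (speed + \<epsilon> / 2)"
    using ekap_upper[OF \<epsilon>2] by blast
  have drift2: "1 * measure_pmf.expectation (path_pmf P (max 1 N') x) (disp w) \<le> real (max 1 N') * (speed + \<epsilon> / 2)" for x w
    using N'[of "max 1 N'" x] expectation_disp_le[of "max 1 N'" x w] by simp
  obtain \<alpha>2 K2 where up: "0 < \<alpha>2" "0 < K2"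
    "\<And>x w n. measure_pmf.prob (path_pmf P n x) {zs. real n * (speed + \<epsilon>) \<le> 1 * disp w zs} \<le> K2 * exp (- \<alpha>2 * real n)"
    by (rule large_deviation_drift[OF _ _ _ drift2, of "speed + \<epsilon>"]) (use \<epsilon> in auto)
  define \<alpha> where "\<alpha> = min \<alpha>1 \<alpha>2"
  have "measure_pmf.prob (path_pmf P n x) {zs. real n * \<epsilon> \<le> \<bar>disp w zs - real n * speed\<bar>}
      \<le> (K1 + K2) * exp (- \<alpha> * real n)" for x w n
  proof -
    have "measure_pmf.prob (path_pmf P n x) {zs. real n * \<epsilon> \<le> \<bar>disp w zs - real n * speed\<bar>} \<le>
      measure_pmf.prob (path_pmf P n x)
        ({zs. real n * (\<epsilon> - speed) \<le> - 1 * disp w zs} \<union> {zs. real n * (speed + \<epsilon>) \<le> 1 * disp w zs})"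
      by (intro measure_pmf.finite_measure_mono) (auto simp: algebra_simps)
    also have "\<dots> \<le> measure_pmf.prob (path_pmf P n x) {zs. real n * (\<epsilon> - speed) \<le> - 1 * disp w zs} +
        measure_pmf.prob (path_pmf P n x) {zs. real n * (speed + \<epsilon>) \<le> 1 * disp w zs}"
      by (rule measure_Un_le) auto
    also have "\<dots> \<le> K1 * exp (- \<alpha>1 * real n) + K2 * exp (- \<alpha>2 * real n)"
      by (intro add_mono low up)
    also have "\<dots> \<le> K1 * exp (- \<alpha> * real n) + K2 * exp (- \<alpha> * real n)"
      using low up by (intro add_mono mult_left_mono) (auto simp: \<alpha>_def intro!: mult_right_mono)
    finally show ?thesis by (simp add: distrib_right)
  qed
  moreover have "0 < \<alpha>" "0 < K1 + K2" using low up by (auto simp: \<alpha>_def)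
  ultimately show ?thesis by blast
qed

lemma busemann_horofun: "busemann b (M zs) (horofun b w) = disp w zs"
  using dist_Y[of w zs] by (simp add: busemann_def horofun_def disp_def Y_def)

text \<open>On finitely many paths \<open>\<xi>\<close> is uniformly approximated by some \<open>horofun b w\<close>.\<close>

lemma prob_busemann_le:
  assumes \<xi>: "\<xi> \<in> horo_compactification b" and r: "r' < r"
    and bound: "\<And>w. measure_pmf.prob (path_pmf P n x) {zs. r' \<le> \<bar>disp w zs - t\<bar>} \<le> q"
  shows "measure_pmf.prob (path_pmf P n x) {zs. r \<le> \<bar>busemann b (M zs) \<xi> - t\<bar>} \<le> q"
proof -
  let ?S = "{zs. r \<le> \<bar>busemann b (M zs) \<xi> - t\<bar>}"
  \<comment> \<open>Pointwise convergence controls only finitely many evaluations at a time, so the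
    countable set of paths is exhausted by finite sets; continuity from below then recovers the full
    event.\<close>
  define F where "F k = {zs::'e list. to_nat zs \<le> k}" for k
  have fin: "finite (F k)" for k
    unfolding F_def using finite_imageD[of to_nat "{zs::'e list. to_nat zs \<le> k}"]
    by (auto intro: finite_subset[of _ "{..k}"] inj_on_subset[OF inj_to_nat])
  have Fq: "measure_pmf.prob (path_pmf P n x) (?S \<inter> F k) \<le> q" for k
  proof -
    let ?U = "{h :: 'h \<Rightarrow> real. \<forall>zs\<in>F k. \<bar>h (Y zs) - \<xi> (Y zs)\<bar> < r - r'}"
    have U: "?U = (\<Inter>zs\<in>F k. {h. \<bar>h (Y zs) - \<xi> (Y zs)\<bar> < r - r'})" by auto
    have "open {h :: 'h \<Rightarrow> real. \<bar>h (Y zs) - \<xi> (Y zs)\<bar> < r - r'}" for zs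
      by (intro open_Collect_less continuous_intros continuous_on_product_coordinates)
    then have "open ?U" unfolding U by (intro open_INT fin ballI)
    moreover have "\<xi> \<in> ?U" using r by simp
    ultimately have "?U \<inter> range (horofun b) \<noteq> {}"
      using \<xi> open_Int_closure_eq_empty[of ?U "range (horofun b)"] unfolding horo_compactification_def by blast
    then obtain w where w: "\<And>zs. zs \<in> F k \<Longrightarrow> \<bar>horofun b w (Y zs) - \<xi> (Y zs)\<bar> < r - r'" by auto
    have "?S \<inter> F k \<subseteq> {zs. r' \<le> \<bar>disp w zs - t\<bar>}"
    proof
      fix zs assume zs: "zs \<in> ?S \<inter> F k"
      then show "zs \<in> {zs. r' \<le> \<bar>disp w zs - t\<bar>}"
        using w[of zs] busemann_horofun[of zs w] by (auto simp: busemann_def Y_def)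
    qed
    then have "measure_pmf.prob (path_pmf P n x) (?S \<inter> F k) \<le> measure_pmf.prob (path_pmf P n x) {zs. r' \<le> \<bar>disp w zs - t\<bar>}"
      by (rule measure_pmf.finite_measure_mono) simp
    then show ?thesis
      using bound[of w] by (rule order_trans)
  qed
  have "(\<lambda>k. measure_pmf.prob (path_pmf P n x) (?S \<inter> F k)) \<longlonglongrightarrow> measure_pmf.prob (path_pmf P n x) (\<Union>k. ?S \<inter> F k)"
    by (intro measure_pmf.finite_Lim_measure_incseq) (auto simp: incseq_def F_def)
  moreover have "(\<Union>k. ?S \<inter> F k) = ?S" by (auto simp: F_def)
  ultimately have "(\<lambda>k. measure_pmf.prob (path_pmf P n x) (?S \<inter> F k)) \<longlonglongrightarrow> measure_pmf.prob (path_pmf P n x) ?S" by simp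
  then show ?thesis by (rule LIMSEQ_le_const2) (use Fq in auto)
qed

lemma busemann_large_deviation:
  assumes nonel: "non_elementary P X b" and \<epsilon>: "0 < \<epsilon>"
  shows "\<exists>\<alpha>>0. \<exists>K>0. \<forall>x. \<forall>\<xi>\<in>horo_compactification b. \<forall>n. measure_pmf.prob (path_pmf P n x)
    {zs. \<bar>busemann b (M zs) \<xi> - real n * speed\<bar> \<ge> real n * \<epsilon>} \<le> K * exp (- \<alpha> * real n)"
proof -
  have "0 < \<epsilon> / 2" using \<epsilon> by simp
  from disp_large_deviation[OF nonel this] obtain \<alpha> K where \<alpha>: "0 < \<alpha>" "0 < K"
    "\<And>x w n. measure_pmf.prob (path_pmf P n x) {zs. real n * (\<epsilon> / 2) \<le> \<bar>disp w zs - real n * speed\<bar>} \<le> K * exp (- \<alpha> * real n)"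
    by blast
  \<comment> \<open>At \<open>n = 0\<close> the thresholds for \<open>\<epsilon>\<close> and
    \<open>\<epsilon> / 2\<close> coincide, leaving no room for approximation; the event has
    probability at most 1, which \<open>max 1 K\<close> covers.\<close>
  have "measure_pmf.prob (path_pmf P n x) {zs. \<bar>busemann b (M zs) \<xi> - real n * speed\<bar> \<ge> real n * \<epsilon>} \<le> max 1 K * exp (- \<alpha> * real n)"
    if \<xi>: "\<xi> \<in> horo_compactification b" for x \<xi> n
  proof (cases "n = 0")
    case True
    then show ?thesis by (simp add: le_max_iff_disj)
  next
    case False
    have "measure_pmf.prob (path_pmf P n x) {zs. real n * \<epsilon> \<le> \<bar>busemann b (M zs) \<xi> - real n * speed\<bar>} \<le> K * exp (- \<alpha> * real n)"
      by (rule prob_busemann_le[OF \<xi> _ \<alpha>(3)]) (use False \<epsilon> in simp)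
    also have "\<dots> \<le> max 1 K * exp (- \<alpha> * real n)"
      by (intro mult_right_mono) auto
    finally show ?thesis .
  qed
  then show ?thesis using \<alpha> by (intro exI[of _ \<alpha>] exI[of _ "max 1 K"] conjI) auto
qed

end

theorem theorem3p6:
  fixes P :: "'e::countable \<Rightarrow> 'e pmf"
    and \<pi> :: "'e pmf"
    and X :: "'e \<Rightarrow> ('h::metric_space \<Rightarrow> 'h)"
    and b :: 'h
    and \<delta> :: real
  assumes geod: "geodesic_space TYPE('h)"
    and hyp: "gromov_hyperbolic \<delta> TYPE('h)"
    and isom: "\<forall>x. isometry (X x)"
    and irr: "irreducible_kernel P"
    and posrec: "positively_recurrent P"
    and stat: "stationary P \<pi>"
    and A1: "cond_A1 P \<pi>"
    and A2: "cond_A2' P X b"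
    and nonel: "non_elementary P X b"
  shows "\<exists>l\<ge>0. \<forall>\<epsilon>>0. \<exists>\<alpha>>0. \<exists>C>0. \<forall>x. \<forall>\<xi>\<in>horo_compactification b. \<forall>n.
           measure_pmf.prob (path_pmf P n x)
             {zs. \<bar>busemann b (walk_prod X zs) \<xi> - real n * l\<bar> \<ge> real n * \<epsilon>}
           \<le> C * exp (- \<alpha> * real n)"
proof -
  obtain C \<rho> where C: "0 < C" "0 < \<rho>" "\<rho> < 1" "\<And>z n. tv_dist (kernel_pow P n z) \<pi> \<le> C * \<rho> ^ n"
    using A1 unfolding cond_A1_def by blast
  obtain a B where a: "0 < a" and
    B: "\<And>x. (\<integral>\<^sup>+ y. ennreal (exp (a * dist (X y b) b)) \<partial>measure_pmf (P x)) \<le> ennreal B"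
    using A2 unfolding cond_A2'_def by blast
  \<comment> \<open>Enlarging \<open>B\<close> to \<open>max 1 B\<close> preserves the moment bound
    and meets the requirement \<open>1 \<le> B\<close> of the locale.\<close>
  interpret ergodic_walk P X b a "max 1 B" \<pi> C \<rho> \<delta>
  proof unfold_locales
    fix x
    show "(\<integral>\<^sup>+ y. ennreal (exp (a * dist (X y b) b)) \<partial>measure_pmf (P x)) \<le> ennreal (max 1 B)"
      using B[of x] by (rule order_trans) (simp add: ennreal_leI)
  qed (use isom a stat C irr hyp in \<open>auto simp: stationary_def\<close>)
  show ?thesis
    using speed_nonneg busemann_large_deviation[OF nonel] by blast
qed

end
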